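(* For each value of $m\in(-1,1)$, $m\neq 0$, there are exactly four (eight when a configuration and its mirror image are counted separately) strictly planar asymmetric relative equilibria configurations of the four-vortex problem with $\Gamma_1=\Gamma_2=1$ and $\Gamma_3=\Gamma_4=m$. They are convex if $m<0$ and concave if $m>0$.
   Context: Four point vortices have distinct positions $x_i\in\mathbb{R}^2$ and strengths $\Gamma_i\in\mathbb{R}\setminus\{0\}$; $r_{ij}=\|x_i-x_j\|$. The configuration is a relative equilibrium (central configuration) if there are $\lambda\in\mathbb{R}\setminus\{0\}$ and $c\in\mathbb{R}^2$ with $-\lambda(x_i-c)=\sum_{j\ne i}\frac{\Gamma_j}{r_{ij}^2}(x_j-x_i)$ for $i=1,\dots,4$. Vortices are labelled, and configurations are counted up to translation, rotation and positive scaling (the count four additionally identifies a configuration with its reflection; the count eight does not). Strictly planar means not collinear; asymmetric means having no line of symmetry. A configuration with no three collinear vortices is concave if one vortex lies strictly inside the convex hull of the other three, and convex if no vortex lies in the convex hull of the other three. *)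

theory Defs
  imports "HOL-Analysis.Analysis"
begin

text \<open>
  The labels are the elements of the four-element type \<open>4\<close>; there the numeral \<open>4\<close>
  denotes \<open>0\<close>, so \<open>1, 2, 3, 4\<close> are four distinct labels and exhaust the type.
\<close>

type_synonym config = "4 \<Rightarrow> real^2"

definition relative_equilibrium :: "(4 \<Rightarrow> real) \<Rightarrow> config \<Rightarrow> bool" where
  "relative_equilibrium \<Gamma> x \<longleftrightarrow>
     inj x \<and>
     (\<exists>\<mu> c. \<mu> \<noteq> (0::real) \<and>
        (\<forall>i. - \<mu> *\<^sub>R (x i - c)
             = (\<Sum>j \<in> UNIV - {i}. (\<Gamma> j / (dist (x i) (x j))\<^sup>2) *\<^sub>R (x j - x i))))"

definition two_pair_strengths :: "real \<Rightarrow> 4 \<Rightarrow> real" where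
  "two_pair_strengths m i = (if i = 1 \<or> i = 2 then 1 else m)"

definition strictly_planar :: "config \<Rightarrow> bool" where
  "strictly_planar x \<longleftrightarrow> \<not> collinear (range x)"

text \<open>Orthogonal reflection of the plane in the line through \<open>p\<close> with unit direction \<open>u\<close>.\<close>

definition line_reflection :: "real^2 \<Rightarrow> real^2 \<Rightarrow> real^2 \<Rightarrow> real^2" where
  "line_reflection p u y = p + (2 * ((y - p) \<bullet> u)) *\<^sub>R u - (y - p)"

text \<open>
  A line of symmetry maps the set of the four positions onto itself; the reflection
  is allowed to permute the labels.
\<close>

definition asymmetric :: "config \<Rightarrow> bool" where
  "asymmetric x \<longleftrightarrow>
     \<not> (\<exists>p u. norm u = 1 \<and> line_reflection p u ` range x = range x)"

definition no_three_collinear :: "config \<Rightarrow> bool" where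
  "no_three_collinear x \<longleftrightarrow>
     (\<forall>i j k. i \<noteq> j \<and> i \<noteq> k \<and> j \<noteq> k \<longrightarrow> \<not> collinear {x i, x j, x k})"

definition concave_config :: "config \<Rightarrow> bool" where
  "concave_config x \<longleftrightarrow>
     no_three_collinear x \<and> (\<exists>i. x i \<in> interior (convex hull (x ` (UNIV - {i}))))"

definition convex_config :: "config \<Rightarrow> bool" where
  "convex_config x \<longleftrightarrow>
     no_three_collinear x \<and> (\<forall>i. x i \<notin> convex hull (x ` (UNIV - {i})))"

text \<open>
  Labelled configurations that agree up to translation, rotation and positive scaling,
  and the coarser relation that in addition admits reflections.
\<close>

definition direct_similar :: "(config \<times> config) set" where
  "direct_similar = {(x, y). \<exists>s A v. s > 0 \<and> rotation_matrix A \<and>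
                        (\<forall>i. y i = s *\<^sub>R (A *v x i) + v)}"

definition similar :: "(config \<times> config) set" where
  "similar = {(x, y). \<exists>s A v. s > 0 \<and> orthogonal_matrix A \<and>
                        (\<forall>i. y i = s *\<^sub>R (A *v x i) + v)}"

definition asymmetric_equilibria :: "real \<Rightarrow> config set" where
  "asymmetric_equilibria m =
     {x. relative_equilibrium (two_pair_strengths m) x \<and> strictly_planar x \<and> asymmetric x}"

end

theory Submission
  imports Defs
begin

text \<open>
  Write \<open>s i j\<close> for the squared distances. Multiplying the equations of a relative equilibrium by
  the strengths and summing shows that \<open>c\<close> is the centre of vorticity. With \<open>lam\<close> the factor \<open>\<mu>\<close>
  divided by the total strength, row \<open>i\<close> of the equation then says that the numbers
  \<open>\<Gamma> j * (1 / s i j - lam)\<close>, completed by a suitable diagonal entry, form an affine dependency of the four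
  points. Points that are not collinear have only one affine dependency up to a factor, so these
  rows are proportional, and by symmetry of \<open>s\<close> one obtains Dziobek's equations
  \<open>1 / s i j = lam * (1 + t * b i * b j)\<close>, in which \<open>\<Gamma> i * b i\<close> is the dependency (lemma
  \<open>dziobek\<close>; the converse is \<open>equilibrium_of_dziobek\<close>). Moreover, because the \<open>s i j\<close> are squared
  distances, the sum over \<open>j\<close> of \<open>\<Gamma> j * b j * s i j\<close> is the same for every \<open>i\<close> (lemma
  \<open>dependency_dist_const\<close>).

  For two pairs of equal strengths put \<open>Q = t * b 1 * b 2\<close>, \<open>V = t * b 3 * b 4\<close> and
  \<open>W = t * (b 3 + b 4)\<^sup>2\<close>. If \<open>b 1 = b 2\<close>, or \<open>b 3 = b 4\<close>, or \<open>b 3 + b 4 = 0\<close>, the configuration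
  is a kite or an isosceles trapezoid and has a line of symmetry. Otherwise the equal-sum
  conditions, divided by \<open>b 1 - b 2\<close> and \<open>b 3 - b 4\<close>, become polynomial equations in \<open>Q\<close>, \<open>V\<close>, \<open>W\<close> that are linear
  in \<open>W\<close>, and their combination collapses to \<open>W * (Q - m) * (1 - m * V) = 0\<close>. So
  \<open>Q = m\<close> or \<open>V = 1 / m\<close>; for \<open>-1 < m < 1\<close> the second case has no real solution and the first
  determines \<open>V\<close> and \<open>W\<close> (lemma \<open>asymmetric_dziobek_solutions\<close>).

  Hence \<open>k = (b 3 - b 4) / (b 3 + b 4)\<close> and \<open>l = (b 1 - b 2) / (m * (b 3 + b 4))\<close> are known up to sign,
  \<open>k\<^sup>2 = (1 - m) / (1 + m)\<close> and \<open>l\<^sup>2 = 4 + k\<^sup>2\<close>, and all ratios of squared distances are rational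
  functions of \<open>k\<close> and \<open>l\<close>. They are realised by the points
  \<open>(l + 1) * (k, r)\<close>, \<open>(l - 1) * (- k, r)\<close>, \<open>(1 - l\<^sup>2, 0)\<close>, \<open>(l\<^sup>2 - 1, 0)\<close> with \<open>r\<^sup>2 = 3\<close>.
  The eight choices of signs of \<open>k\<close>, \<open>l\<close> and \<open>r\<close> are the eight configurations up to direct
  similarity. The signs of \<open>l\<close> and \<open>k\<close> correspond to exchanging the labels within the first and the
  second pair (up to a reflection), and that of \<open>r\<close> to a reflection, which leaves four
  configurations once reflections are admitted. The signs of the coefficients of the affine dependency decide between convex and concave.
\<close>

section \<open>Affine dependencies of four points in the plane\<close>

lemma labels_distinct [simp]: "(1::4) \<noteq> 2" "(1::4) \<noteq> 3" "(1::4) \<noteq> 4" "(2::4) \<noteq> 3" "(2::4) \<noteq> 4" "(3::4) \<noteq> 4"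
  by simp_all

lemma dist_plane: "(dist x y)\<^sup>2 = (x $ 1 - y $ 1)\<^sup>2 + (x $ 2 - y $ 2)\<^sup>2" for x y :: "real^2"
  unfolding dist_norm power2_norm_eq_inner by (simp add: inner_vec_def sum_2 power2_eq_square)

text \<open>
  The coefficients are the signed areas of the four triangles; Cramer's rule shows that every
  other dependency is proportional to them, and they vanish together only for collinear points.
\<close>

lemma planar_dependencies:
  fixes x :: config
  assumes "inj x" and "\<not> collinear (range x)"
  obtains w where "\<exists>i. w i \<noteq> 0" and "(\<Sum>i\<in>UNIV. w i) = 0" and "(\<Sum>i\<in>UNIV. w i *\<^sub>R x i) = 0"
    and "\<And>z. (\<Sum>i\<in>UNIV. z i) = 0 \<Longrightarrow> (\<Sum>i\<in>UNIV. z i *\<^sub>R x i) = 0 \<Longrightarrow> \<exists>c. \<forall>i. z i = c * w i"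
proof -
  define D where "D a b c = (x b $ 1 - x a $ 1) * (x c $ 2 - x a $ 2) - (x b $ 2 - x a $ 2) * (x c $ 1 - x a $ 1)"
    for a b c
  define w :: "4 \<Rightarrow> real" where "w i = (if i = 1 then D 2 3 4 else if i = 2 then - D 1 3 4
     else if i = 3 then D 1 2 4 else - D 1 2 3)" for i
  have w: "w 1 = D 2 3 4" "w 2 = - D 1 3 4" "w 3 = D 1 2 4" "w 4 = - D 1 2 3"
    unfolding w_def by simp_all
  have "\<exists>i. w i \<noteq> 0"
  proof (rule ccontr)
    assume "\<not> ?thesis"
    (* Since x 1 and x 2 differ, two of the four areas suffice for collinearity. *)
    then have D0: "D 1 2 3 = 0" "D 1 2 4 = 0" using w by auto
    have ne: "x 1 \<noteq> x 2" using assms(1) by (simp add: inj_eq)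
    have "\<exists>c. x i = x 1 + c *\<^sub>R (x 2 - x 1)" for i
    proof -
      have D: "D 1 2 i = 0" using D0 exhaust_4[of i] by (auto simp: D_def)
      show ?thesis
      proof (cases "x 2 $ 1 = x 1 $ 1")
        case True
        with ne have "x 2 $ 2 \<noteq> x 1 $ 2" by (auto simp: vec_eq_iff forall_2)
        moreover have "x i $ 1 = x 1 $ 1" using calculation True D by (simp add: D_def)
        ultimately show ?thesis using True
          by (intro exI[of _ "(x i $ 2 - x 1 $ 2) / (x 2 $ 2 - x 1 $ 2)"])
             (simp add: vec_eq_iff forall_2)
      next
        case False
        moreover have "(x i $ 1 - x 1 $ 1) * (x 2 $ 2 - x 1 $ 2) = (x i $ 2 - x 1 $ 2) * (x 2 $ 1 - x 1 $ 1)"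
          using D by (simp add: D_def mult.commute)
        ultimately show ?thesis
          by (intro exI[of _ "(x i $ 1 - x 1 $ 1) / (x 2 $ 1 - x 1 $ 1)"])
             (simp add: vec_eq_iff forall_2)
      qed
    qed
    then have "collinear (range x)" unfolding collinear_alt by blast
    with assms(2) show False by simp
  qed
  then obtain l where l: "w l \<noteq> 0" by blast
  have "(\<Sum>i\<in>UNIV. w i) = 0" unfolding sum_4 w D_def by algebra
  moreover have "(\<Sum>i\<in>UNIV. w i *\<^sub>R x i) = 0"
    by (simp add: vec_eq_iff forall_2 sum_4 w D_def) algebra
  moreover have "\<exists>c. \<forall>i. z i = c * w i"
    if z: "(\<Sum>i\<in>UNIV. z i) = 0" "(\<Sum>i\<in>UNIV. z i *\<^sub>R x i) = 0" for z
  proof -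
    have z0: "z 4 = - z 1 - z 2 - z 3" using z(1) by (simp add: sum_4)
    have z1: "z 1 * x 1 $ 1 + z 2 * x 2 $ 1 + z 3 * x 3 $ 1 + z 4 * x 4 $ 1 = 0"
      "z 1 * x 1 $ 2 + z 2 * x 2 $ 2 + z 3 * x 3 $ 2 + z 4 * x 4 $ 2 = 0"
      using z(2) by (simp_all add: vec_eq_iff forall_2 sum_4)
    have "z 1 * w 2 = z 2 * w 1" "z 1 * w 3 = z 3 * w 1" "z 1 * w 4 = z 4 * w 1"
      "z 2 * w 3 = z 3 * w 2" "z 2 * w 4 = z 4 * w 2" "z 3 * w 4 = z 4 * w 3"
      using z1 unfolding z0 w D_def by algebra+
    then have "\<forall>i j. z i * w j = z j * w i" by (simp add: forall_4)
    then have "\<forall>i. z i = z l / w l * w i" using l by (simp add: field_simps)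
    then show ?thesis by blast
  qed
  ultimately show ?thesis using that l by blast
qed

text \<open>
  Expanding the squares, the terms that involve \<open>x i\<close> are multiples of the two vanishing sums.
\<close>

lemma dependency_dist_const:
  fixes x :: config
  assumes "(\<Sum>i\<in>UNIV. w i) = 0" and "(\<Sum>i\<in>UNIV. w i *\<^sub>R x i) = 0"
  shows "(\<Sum>j\<in>UNIV. w j * (dist (x i) (x j))\<^sup>2) = (\<Sum>j\<in>UNIV. w j * (norm (x j))\<^sup>2)"
proof -
  have "(\<Sum>j\<in>UNIV. w j * (dist (x i) (x j))\<^sup>2)
     = (\<Sum>j\<in>UNIV. w j * (norm (x j))\<^sup>2) + (\<Sum>j\<in>UNIV. w j) * (norm (x i))\<^sup>2 - 2 * (x i \<bullet> (\<Sum>j\<in>UNIV. w j *\<^sub>R x j))"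
    by (simp add: dist_norm power2_norm_eq_inner inner_diff inner_commute algebra_simps sum.distrib
       sum_subtractf sum_distrib_right sum_distrib_left inner_sum_right)
  then show ?thesis using assms by simp
qed

section \<open>Dziobek's equations\<close>

text \<open>
  With \<open>S i j = 1 / (dist (x i) (x j))\<^sup>2 - lam\<close>, the \<open>i\<close>th equation is an affine dependency with
  coefficients \<open>\<Gamma> j * S i j\<close> off the diagonal, so \<open>S i j = k i * b j\<close>; the symmetry of \<open>S\<close> then
  makes \<open>k i\<close> proportional to \<open>b i\<close>.
\<close>

lemma dziobek:
  fixes x :: config
  assumes re: "relative_equilibrium \<Gamma> x" and nc: "\<not> collinear (range x)"
    and G: "\<And>i. \<Gamma> i \<noteq> 0" "(\<Sum>i\<in>UNIV. \<Gamma> i) \<noteq> 0"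
  obtains lam t b where "lam \<noteq> 0" "(\<Sum>i\<in>UNIV. \<Gamma> i * b i) = 0" "(\<Sum>i\<in>UNIV. (\<Gamma> i * b i) *\<^sub>R x i) = 0"
    and "\<And>i j. i \<noteq> j \<Longrightarrow> 1 / (dist (x i) (x j))\<^sup>2 = lam * (1 + t * b i * b j)"
proof -
  obtain \<mu> c where inj: "inj x" and mu: "\<mu> \<noteq> 0" and
    eq: "\<And>i. - \<mu> *\<^sub>R (x i - c) = (\<Sum>j \<in> UNIV - {i}. (\<Gamma> j / (dist (x i) (x j))\<^sup>2) *\<^sub>R (x j - x i))"
    using re unfolding relative_equilibrium_def by blast
  define G where "G = (\<Sum>i\<in>UNIV. \<Gamma> i)"
  define lam where "lam = \<mu> / G"
  have eq': "- \<mu> *\<^sub>R (x i - c) = (\<Sum>j\<in>UNIV. (\<Gamma> j / (dist (x i) (x j))\<^sup>2) *\<^sub>R (x j - x i))" for i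
    unfolding eq by (simp add: sum.remove[of UNIV i])
  have "(\<Sum>i\<in>UNIV. \<Gamma> i *\<^sub>R (- \<mu> *\<^sub>R (x i - c)))
    = (\<Sum>i\<in>UNIV. \<Sum>j\<in>UNIV. (\<Gamma> i * \<Gamma> j / (dist (x i) (x j))\<^sup>2) *\<^sub>R (x j - x i))" (is "?L = ?S")
    by (simp only: eq' scaleR_sum_right scaleR_scaleR times_divide_eq_right)
  moreover have "?S = - ?S"
    by (subst sum.swap) (simp add: sum_negf[symmetric] dist_commute mult.commute algebra_simps flip: scaleR_minus_right)
  then have "?S + ?S = 0" by (rule eq_neg_iff_add_eq_0[THEN iffD1])
  then have "2 *\<^sub>R ?S = 0" by (simp only: scaleR_2)
  ultimately have "?L = 0" by simp
  then have "\<mu> *\<^sub>R (\<Sum>i\<in>UNIV. \<Gamma> i *\<^sub>R (x i - c)) = 0"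
    by (simp add: scaleR_sum_right sum_negf mult.commute)
  then have cen: "(\<Sum>i\<in>UNIV. \<Gamma> i *\<^sub>R x i) = G *\<^sub>R c"
    using mu by (simp add: scaleR_diff_right sum_subtractf G_def scaleR_left.sum)
  obtain w where w: "\<exists>i. w i \<noteq> 0" "(\<Sum>i\<in>UNIV. w i) = 0" "(\<Sum>i\<in>UNIV. w i *\<^sub>R x i) = 0"
    and uniq: "\<And>z. (\<Sum>i\<in>UNIV. z i) = 0 \<Longrightarrow> (\<Sum>i\<in>UNIV. z i *\<^sub>R x i) = 0 \<Longrightarrow> \<exists>c. \<forall>i. z i = c * w i"
    using planar_dependencies[OF inj nc] by blast
  define S where "S i j = 1 / (dist (x i) (x j))\<^sup>2 - lam" for i j
  have Ssym: "S i j = S j i" for i j by (simp add: S_def dist_commute)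
  have "\<exists>k. \<forall>j. j \<noteq> i \<longrightarrow> \<Gamma> j * S i j = k * w j" for i
  proof -
    (* The diagonal entry is chosen so that the row sums to zero; it does not contribute to the
       vector sum of the differences x j - x i. *)
    define z where "z j = \<Gamma> j * S i j - (if j = i then \<Sum>j\<in>UNIV. \<Gamma> j * S i j else 0)" for j
    have z1: "(\<Sum>j\<in>UNIV. z j) = 0" by (simp add: z_def sum_subtractf)
    have "(\<Sum>j\<in>UNIV. z j *\<^sub>R x j) = (\<Sum>j\<in>UNIV. z j *\<^sub>R x j) - (\<Sum>j\<in>UNIV. z j) *\<^sub>R x i" using z1 by simp
    also have "\<dots> = (\<Sum>j\<in>UNIV. z j *\<^sub>R (x j - x i))"
      by (simp add: scaleR_diff_right sum_subtractf scaleR_left.sum)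
    also have "\<dots> = (\<Sum>j\<in>UNIV. (\<Gamma> j * S i j) *\<^sub>R (x j - x i))"
      by (rule sum.cong) (auto simp: z_def)
    also have "\<dots> = - \<mu> *\<^sub>R (x i - c) - lam *\<^sub>R (\<Sum>j\<in>UNIV. \<Gamma> j *\<^sub>R (x j - x i))"
      unfolding eq' scaleR_sum_right sum_subtractf[symmetric]
      by (rule sum.cong) (auto simp: S_def algebra_simps)
    also have "(\<Sum>j\<in>UNIV. \<Gamma> j *\<^sub>R (x j - x i)) = G *\<^sub>R (c - x i)"
      unfolding scaleR_diff_right sum_subtractf cen by (simp add: G_def scaleR_left.sum)
    also have "- \<mu> *\<^sub>R (x i - c) - lam *\<^sub>R G *\<^sub>R (c - x i) = 0"
      using G(2) unfolding lam_def G_def[symmetric] by (simp add: algebra_simps)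
    finally obtain k where k: "\<forall>j. z j = k * w j" using uniq[OF z1] by blast
    have "z j = \<Gamma> j * S i j" if "j \<noteq> i" for j using that by (simp add: z_def)
    with k show ?thesis by (intro exI[of _ k]) simp
  qed
  then obtain k where k: "\<And>i j. j \<noteq> i \<Longrightarrow> \<Gamma> j * S i j = k i * w j" by metis
  define b where "b i = w i / \<Gamma> i" for i
  have wb: "w i = \<Gamma> i * b i" for i using G by (simp add: b_def)
  have Sk: "S i j = k i * b j" if "j \<noteq> i" for i j
    using k[OF that] G(1)[of j] by (simp add: b_def field_simps)
  obtain l where l: "b l \<noteq> 0" using w(1) G(1) unfolding b_def by auto
  have kl: "k i = k l / b l * b i" for i
    using Sk[of l i] Sk[of i l] Ssym[of i l] l by (cases "i = l") (auto simp: field_simps)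
  have SS: "S i j = k l / b l * b i * b j" if "j \<noteq> i" for i j using Sk[OF that] kl[of i] by simp
  have L0: "lam \<noteq> 0" using mu G by (simp add: lam_def G_def)
  show ?thesis
  proof (rule that[of lam b "k l / b l / lam"])
    show "1 / (dist (x i) (x j))\<^sup>2 = lam * (1 + k l / b l / lam * b i * b j)" if "i \<noteq> j" for i j
      using SS[of j i] that L0 unfolding S_def by (simp add: algebra_simps)
  qed (use l w L0 in \<open>auto simp: wb[symmetric]\<close>)
qed

text \<open>
  In the \<open>i\<close>th sum the terms with \<open>b j\<close> cancel because they form a dependency, and the others
  add up to a multiple of \<open>c - x i\<close>.
\<close>

lemma equilibrium_of_dziobek:
  fixes x :: config
  assumes "inj x" and G: "(\<Sum>i\<in>UNIV. \<Gamma> i) \<noteq> 0" and lam: "lam \<noteq> 0"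
    and b: "(\<Sum>i\<in>UNIV. \<Gamma> i * b i) = 0" "(\<Sum>i\<in>UNIV. (\<Gamma> i * b i) *\<^sub>R x i) = 0"
    and d: "\<And>i j. i \<noteq> j \<Longrightarrow> 1 / (dist (x i) (x j))\<^sup>2 = lam * (1 + t * b i * b j)"
  shows "relative_equilibrium \<Gamma> x"
proof -
  define G where "G = (\<Sum>i\<in>UNIV. \<Gamma> i)"
  define c where "c = (1 / G) *\<^sub>R (\<Sum>i\<in>UNIV. \<Gamma> i *\<^sub>R x i)"
  have G0: "G \<noteq> 0" using G by (simp add: G_def)
  have "- (lam * G) *\<^sub>R (x i - c) = (\<Sum>j\<in>UNIV - {i}. (\<Gamma> j / (dist (x i) (x j))\<^sup>2) *\<^sub>R (x j - x i))" for i
  proof -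
    have "(\<Sum>j\<in>UNIV - {i}. (\<Gamma> j / (dist (x i) (x j))\<^sup>2) *\<^sub>R (x j - x i))
      = (\<Sum>j\<in>UNIV - {i}. (lam * \<Gamma> j + lam * t * b i * (\<Gamma> j * b j)) *\<^sub>R (x j - x i))"
    proof (rule sum.cong)
      fix j assume "j \<in> UNIV - {i}"
      then have "\<Gamma> j / (dist (x i) (x j))\<^sup>2 = \<Gamma> j * (lam * (1 + t * b i * b j))"
        using d[of i j] by (metis Diff_iff insertCI times_divide_eq_right mult.right_neutral)
      then show "(\<Gamma> j / (dist (x i) (x j))\<^sup>2) *\<^sub>R (x j - x i)
        = (lam * \<Gamma> j + lam * t * b i * (\<Gamma> j * b j)) *\<^sub>R (x j - x i)"
        by (simp add: algebra_simps)
    qed simp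
    also have "\<dots> = (\<Sum>j\<in>UNIV. (lam * \<Gamma> j + lam * t * b i * (\<Gamma> j * b j)) *\<^sub>R (x j - x i))"
      by (simp add: sum.remove[of UNIV i])
    also have "\<dots> = lam *\<^sub>R (\<Sum>j\<in>UNIV. \<Gamma> j *\<^sub>R (x j - x i))
       + (lam * t * b i) *\<^sub>R (\<Sum>j\<in>UNIV. (\<Gamma> j * b j) *\<^sub>R (x j - x i))"
      by (simp add: scaleR_sum_right scaleR_left_distrib sum.distrib)
    also have "\<dots> = lam *\<^sub>R ((\<Sum>j\<in>UNIV. \<Gamma> j *\<^sub>R x j) - G *\<^sub>R x i)
       + (lam * t * b i) *\<^sub>R ((\<Sum>j\<in>UNIV. (\<Gamma> j * b j) *\<^sub>R x j) - (\<Sum>j\<in>UNIV. \<Gamma> j * b j) *\<^sub>R x i)"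
      by (simp add: G_def scaleR_left.sum scaleR_diff_right sum_subtractf)
    also have "\<dots> = - (lam * G) *\<^sub>R (x i - c)"
      using G0 unfolding b c_def by (simp add: algebra_simps)
    finally show ?thesis by simp
  qed
  then show ?thesis unfolding relative_equilibrium_def using assms(1) lam G0
    by (metis mult_eq_0_iff)
qed

section \<open>The asymmetric solutions of Dziobek's equations\<close>

text \<open>
  Here \<open>gij\<close> is \<open>1 + t * b i * b j\<close> and \<open>T\<close> is the common value of the sums of the \<open>\<Gamma> j * b j / gij\<close>.
  The difference of two such sums within a pair has the factor \<open>b 1 - b 2\<close> or \<open>b 3 - b 4\<close>; the
  remaining factors, and the sum of all four conditions weighted by \<open>\<Gamma> i * b i\<close>, are symmetric
  under both exchanges and therefore, with \<open>b 1 + b 2 = - m * (b 3 + b 4)\<close>, give polynomials in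
  \<open>Q\<close>, \<open>V\<close> and \<open>W\<close>.
\<close>

lemma asymmetric_dziobek_solutions:
  fixes b1 b2 b3 b4 t m T g12 g13 g14 g23 g24 g34 :: real
  assumes lin: "b1 + b2 + m * b3 + m * b4 = 0"
    and g: "g12 = 1 + t * b1 * b2" "g13 = 1 + t * b1 * b3" "g14 = 1 + t * b1 * b4"
           "g23 = 1 + t * b2 * b3" "g24 = 1 + t * b2 * b4" "g34 = 1 + t * b3 * b4"
    and nz: "g12 \<noteq> 0" "g13 \<noteq> 0" "g14 \<noteq> 0" "g23 \<noteq> 0" "g24 \<noteq> 0" "g34 \<noteq> 0"
    and t1: "b2 / g12 + m * b3 / g13 + m * b4 / g14 = T"
    and t2: "b1 / g12 + m * b3 / g23 + m * b4 / g24 = T"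
    and t3: "b1 / g13 + b2 / g23 + m * b4 / g34 = T"
    and t4: "b1 / g14 + b2 / g24 + m * b3 / g34 = T"
    and ne: "b1 \<noteq> b2" "b3 \<noteq> b4" "b3 + b4 \<noteq> 0" "t \<noteq> 0"
    and m: "-1 < m" "m < 1" "m \<noteq> 0"
  shows "t * b1 * b2 = m \<and> t * b3 * b4 = - 1 / (m + 2)
       \<and> t * (b3 + b4)\<^sup>2 = - 2 * (m + 1) / (m * (m + 2))"
proof -
  define Q V W P where "Q = t * b1 * b2" and "V = t * b3 * b4" and "W = t * (b3 + b4)\<^sup>2"
    and "P = g13 * g23 * g14 * g24"
  define X where "X = t * (b3\<^sup>2 * g14 * g24 + b4\<^sup>2 * g13 * g23)"
  define Y where "Y = t * (b1\<^sup>2 * g23 * g24 + b2\<^sup>2 * g13 * g14)"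
  have b2: "b2 = - m * (b3 + b4) - b1" using lin by (simp add: algebra_simps)
  have P0: "P \<noteq> 0" using nz by (simp add: P_def)
  have gQ: "g12 = 1 + Q" and gV: "g34 = 1 + V" by (simp_all add: g Q_def V_def)
  have Peq: "P = (1 - Q*V)\<^sup>2 + W * (Q - m) * (1 - m*V)"
    unfolding P_def Q_def V_def W_def g b2 by algebra
  have Xeq: "X = W * (1 - m*V) - 2 * V * (1 - Q*V)"
    unfolding X_def Q_def V_def W_def g b2 by algebra
  have Yeq: "Y = m * W * (m - Q) - 2 * Q * (1 - Q*V)"
    unfolding Y_def Q_def V_def W_def g b2 by algebra
  (* t1 - t2, divided by b2 - b1 and multiplied by all mixed g and g12. *)
  have E1: "P + m * (1 + Q) * X = 0"
  proof -
    have "(b2 - b1) * (P + m * g12 * X) = 0"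
    proof -
      have "b2 / g12 + m * b3 / g13 + m * b4 / g14 = b1 / g12 + m * b3 / g23 + m * b4 / g24"
        using t1 t2 by simp
      then have "b2 * P + m * b3 * g12 * g23 * g14 * g24 + m * b4 * g12 * g13 * g23 * g24
        = b1 * P + m * b3 * g12 * g13 * g14 * g24 + m * b4 * g12 * g13 * g23 * g14"
        using nz unfolding P_def by (simp add: divide_simps split: if_splits) algebra
      then show ?thesis unfolding X_def P_def g by algebra
    qed
    then show ?thesis using ne gQ by simp
  qed
  (* t3 - t4, divided by b4 - b3 and multiplied by all mixed g and g34. *)
  have E2: "m * P + (1 + V) * Y = 0"
  proof -
    have "(b4 - b3) * (m * P + g34 * Y) = 0"
    proof -
      have "b1 / g13 + b2 / g23 + m * b4 / g34 = b1 / g14 + b2 / g24 + m * b3 / g34"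
        using t3 t4 by simp
      then have "m * b4 * P + b1 * g34 * g23 * g14 * g24 + b2 * g34 * g13 * g14 * g24
        = m * b3 * P + b1 * g34 * g13 * g23 * g24 + b2 * g34 * g13 * g23 * g14"
        using nz unfolding P_def by (simp add: divide_simps split: if_splits) algebra
      then show ?thesis unfolding Y_def P_def g by algebra
    qed
    then show ?thesis using ne gV by simp
  qed
  define M where "M = t * (b1*b3*g23*g14*g24 + b2*b3*g13*g14*g24 + b1*b4*g13*g23*g24 + b2*b4*g13*g23*g14)"
  have Meq: "M = Q * X + V * Y + P - (1 - Q*V)\<^sup>2"
    unfolding Xeq Yeq Peq unfolding M_def Q_def V_def W_def g b2 by algebra
  (* The weighted sum of the four conditions: its right-hand side is T times the vanishing sum of
     the weights, and on the left each pair of indices occurs twice. *)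
  have E3: "Q * P * g34 + m\<^sup>2 * V * P * g12 + m * M * g12 * g34 = 0"
  proof -
    have "b1 * T + b2 * T + m * b3 * T + m * b4 * T = 0"
      using lin by algebra
    then have "b1 * (b2 / g12 + m * b3 / g13 + m * b4 / g14)
      + b2 * (b1 / g12 + m * b3 / g23 + m * b4 / g24)
      + m * b3 * (b1 / g13 + b2 / g23 + m * b4 / g34)
      + m * b4 * (b1 / g14 + b2 / g24 + m * b3 / g34) = 0"
      using t1 t2 t3 t4 by simp
    then have "2 * (b1 * b2 / g12 + m\<^sup>2 * b3 * b4 / g34
      + m * (b1 * b3 / g13 + b2 * b3 / g23 + b1 * b4 / g14 + b2 * b4 / g24)) = 0"
      by (simp add: algebra_simps power2_eq_square)
    then have "(b1 * b2 / g12 + m\<^sup>2 * b3 * b4 / g34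
      + m * (b1 * b3 / g13 + b2 * b3 / g23 + b1 * b4 / g14 + b2 * b4 / g24)) * (P * g12 * g34) = 0"
      by simp
    moreover have "(b1 * b2 / g12 + m\<^sup>2 * b3 * b4 / g34
      + m * (b1 * b3 / g13 + b2 * b3 / g23 + b1 * b4 / g14 + b2 * b4 / g24)) * (P * g12 * g34)
      = b1 * b2 * P * g34 + m\<^sup>2 * b3 * b4 * P * g12
       + m * (b1*b3*g23*g14*g24 + b2*b3*g13*g14*g24 + b1*b4*g13*g23*g24 + b2*b4*g13*g23*g14) * g12 * g34"
      using nz unfolding P_def by (simp add: field_simps)
    ultimately show ?thesis unfolding M_def Q_def V_def by algebra
  qed
  (* E1 and E2 replace P / g12 and P / g34 in E3 by multiples of X and Y; comparing with Meq leaves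
     P = (1 - QV)^2, and Peq turns this into a product. *)
  have "m * g12 * g34 * (M - Q * X - V * Y) = 0"
    using E1 E2 E3 unfolding gQ gV by algebra
  then have "M = Q * X + V * Y" using m nz by simp
  then have fac: "W * (Q - m) * (1 - m*V) = 0" using Meq Peq by simp
  have W0: "W \<noteq> 0" using ne by (simp add: W_def)
  have F1: "(1 - Q*V) * (1 - Q*V - 2*m*V - 2*m*Q*V) + W * (1 - m*V) * Q * (1 + m) = 0"
    using E1 unfolding Peq Xeq by algebra
  have F2: "(1 - Q*V) * (m - m*Q*V - 2*Q - 2*Q*V) - m * W * V * (Q - m) * (1 + m) = 0"
    using E2 unfolding Peq Yeq by algebra
  have QV: "1 - Q*V \<noteq> 0" using P0 Peq fac by auto
  have m1: "m + 1 \<noteq> 0" "m + 2 \<noteq> 0" using m by auto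
  consider (A) "Q = m" | (B) "m * V = 1" using fac W0 by auto
  then show ?thesis
  proof cases
    case A
    have "m - m*m*V - 2*m - 2*m*V = 0" using F2 QV A by simp
    then have "m * ((m + 2) * V + 1) = 0" by algebra
    then have Vm: "(m + 2) * V = -1" using m by simp
    then have V: "V = - 1 / (m + 2)" using m1 by (simp add: field_simps)
    have "(1 - m*V) * (1 - m*V - 2*m*V - 2*m*m*V + W * m * (1 + m)) = 0"
      using F1 unfolding A by algebra
    then have "1 - m*V - 2*m*V - 2*m*m*V + W * m * (1 + m) = 0" using QV A by simp
    then have "(m + 1) * (W * m * (m + 2) + 2 * (m + 1)) = 0" using Vm by algebra
    then have "W * m * (m + 2) + 2 * (m + 1) = 0" using m1 by simp
    then have "W * (m * (m + 2)) = - 2 * (m + 1)" by algebra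
    then have "W = - 2 * (m + 1) / (m * (m + 2))" using m m1 by (simp add: nonzero_eq_divide_eq)
    then show ?thesis using A V unfolding Q_def V_def W_def by simp
  next
    case B
    (* The solution with the roles of the two pairs exchanged (m replaced by 1/m). It is not real
       for |m| < 1: the square of t (b3 + b4) (b1 - b2) would be negative. *)
    have "(1 - Q*V) * (1 - Q*V - 2*m*V - 2*m*Q*V) = 0" using F1 B by simp
    then have "1 - Q*V - 2*m*V - 2*m*Q*V = 0" using QV by simp
    then have Q: "Q * (2*m + 1) = - m" using B by algebra
    then have m2: "2*m + 1 \<noteq> 0" using m by auto
    have "(1 - Q*V) * (m - m*Q*V - 2*Q - 2*Q*V + m * W * (1 + m)) = 0"
      using F2 B by algebra
    then have "m - m*Q*V - 2*Q - 2*Q*V + m * W * (1 + m) = 0" using QV by simp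
    then have "(m+1) * (m * W * (2*m + 1) + 2 * (m + 1)) = 0"
      using Q B by algebra
    then have W: "m * W * (2*m + 1) = - 2 * (m + 1)" using m1 by simp
    have "(W * (m\<^sup>2 * W - 4 * Q)) * (2*m + 1)\<^sup>2 = - 4 * (1 + m) * (1 - m)"
      using W Q by algebra
    also have "\<dots> < 0" using m by (intro mult_neg_pos) simp_all
    finally have "W * (m\<^sup>2 * W - 4 * Q) < 0"
      by (metis zero_le_power2 mult_nonneg_nonneg not_less)
    moreover have "W * (m\<^sup>2 * W - 4 * Q) = (t * (b3 + b4) * (b1 - b2))\<^sup>2"
      unfolding W_def Q_def b2 by algebra
    ultimately show ?thesis by simp
  qed
qed

section \<open>The explicit configurations\<close>

text \<open>
  The third and fourth vortex lie on the first axis, symmetric about the origin; the other two are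
  scaled copies of \<open>(k, r)\<close> and of its mirror image \<open>(- k, r)\<close>. Changing the sign of \<open>l\<close>
  exchanges the first two points up to a reflection in the first axis, and changing the sign of
  \<open>k\<close> exchanges the last two up to a reflection in the second axis.
\<close>

definition canonical_config :: "real \<Rightarrow> real \<Rightarrow> real \<Rightarrow> config" where
  "canonical_config k l r i = (if i = 1 then vector [(l + 1) * k, (l + 1) * r]
     else if i = 2 then vector [- ((l - 1) * k), (l - 1) * r]
     else if i = 3 then vector [1 - l\<^sup>2, 0] else vector [l\<^sup>2 - 1, 0])"

lemma canonical_config_simps:
  "canonical_config k l r 1 = vector [(l + 1) * k, (l + 1) * r]"
  "canonical_config k l r 2 = vector [- ((l - 1) * k), (l - 1) * r]"
  "canonical_config k l r 3 = vector [1 - l\<^sup>2, 0]"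
  "canonical_config k l r 4 = vector [l\<^sup>2 - 1, 0]"
  unfolding canonical_config_def by simp_all

definition canonical_parameters :: "real \<Rightarrow> (real \<times> real \<times> real) set" where
  "canonical_parameters m = {(k, l, r). k\<^sup>2 = (1 - m) / (1 + m) \<and> l\<^sup>2 = 4 + k\<^sup>2 \<and> r\<^sup>2 = 3}"

text \<open>
  The solution \<open>b\<close> of Dziobek's equations, normalised by \<open>b 3 + b 4 = 1\<close>.
\<close>

definition canonical_weight :: "real \<Rightarrow> real \<Rightarrow> real \<Rightarrow> 4 \<Rightarrow> real" where
  "canonical_weight m k l i = (if i = 1 then m * (l - 1) / 2 else if i = 2 then - (m * (l + 1) / 2)
     else if i = 3 then (1 + k) / 2 else (1 - k) / 2)"

lemma canonical_weight_simps:
  "canonical_weight m k l 1 = m * (l - 1) / 2"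
  "canonical_weight m k l 2 = - (m * (l + 1) / 2)"
  "canonical_weight m k l 3 = (1 + k) / 2"
  "canonical_weight m k l 4 = (1 - k) / 2"
  unfolding canonical_weight_def by simp_all

lemma two_pair_strengths_simps [simp]:
  "two_pair_strengths m 1 = 1" "two_pair_strengths m 2 = 1"
  "two_pair_strengths m 3 = m" "two_pair_strengths m 4 = m"
  unfolding two_pair_strengths_def by simp_all

lemma canonical_weight_sums:
  "(\<Sum>i\<in>UNIV. two_pair_strengths m i * canonical_weight m k l i) = 0"
  "(\<Sum>i\<in>UNIV. (two_pair_strengths m i * canonical_weight m k l i) *\<^sub>R canonical_config k l r i) = 0"
  by (simp_all add: sum_4 canonical_weight_simps canonical_config_simps vec_eq_iff forall_2
      field_simps power2_eq_square)

lemma canonical_dist: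
  assumes "l\<^sup>2 = 4 + k\<^sup>2" "r\<^sup>2 = 3"
  shows "(dist (canonical_config k l r 1) (canonical_config k l r 2))\<^sup>2 = 4 * (k\<^sup>2 + 1) * (l\<^sup>2 - 1)"
    "(dist (canonical_config k l r 1) (canonical_config k l r 3))\<^sup>2 = 2 * (l\<^sup>2 - 1) * (l + 1) * (l + k)"
    "(dist (canonical_config k l r 1) (canonical_config k l r 4))\<^sup>2 = 2 * (l\<^sup>2 - 1) * (l + 1) * (l - k)"
    "(dist (canonical_config k l r 2) (canonical_config k l r 3))\<^sup>2 = 2 * (l\<^sup>2 - 1) * (l - 1) * (l - k)"
    "(dist (canonical_config k l r 2) (canonical_config k l r 4))\<^sup>2 = 2 * (l\<^sup>2 - 1) * (l - 1) * (l + k)"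
    "(dist (canonical_config k l r 3) (canonical_config k l r 4))\<^sup>2 = 4 * (l\<^sup>2 - 1)\<^sup>2"
  unfolding dist_plane canonical_config_simps vector_2
  using assms by (algebra, algebra, algebra, algebra, algebra, simp add: algebra_simps power2_eq_square)

lemma canonical_nonzero:
  fixes k l :: real
  assumes "l\<^sup>2 = 4 + k\<^sup>2"
  shows "l\<^sup>2 > 1" "l + 1 \<noteq> 0" "l - 1 \<noteq> 0" "l + k \<noteq> 0" "l - k \<noteq> 0"
proof -
  show l: "l\<^sup>2 > 1" using assms zero_le_power2[of k] by linarith
  then show "l + 1 \<noteq> 0" "l - 1 \<noteq> 0" by (auto simp: eq_neg_iff_add_eq_0[symmetric])
  have "(l + k) * (l - k) = 4" using assms by algebra
  then show "l + k \<noteq> 0" "l - k \<noteq> 0" by auto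
qed

lemma canonical_inj:
  assumes "l\<^sup>2 = 4 + k\<^sup>2" "r\<^sup>2 = 3"
  shows "inj (canonical_config k l r)"
proof -
  note nz = canonical_nonzero[OF assms(1)]
  have "k\<^sup>2 + 1 \<noteq> 0" using zero_le_power2[of k] by linarith
  moreover have "l\<^sup>2 - 1 \<noteq> 0" using nz by linarith
  moreover from this have "(l\<^sup>2 - 1)\<^sup>2 \<noteq> 0" by simp
  ultimately have "(dist (canonical_config k l r i) (canonical_config k l r j))\<^sup>2 \<noteq> 0" if "i \<noteq> j" for i j
    using that exhaust_4[of i] exhaust_4[of j] nz(2-5) canonical_dist[OF assms]
    by (auto simp: dist_commute simp del: zero_eq_power2 power_eq_0_iff)
  then show ?thesis by (force intro: injI)
qed

text \<open>
  All six values of \<open>1 + W * b i * b j\<close> factor: they are \<open>(l - k) / (l + 1)\<close>, \<open>(l + k) / (l + 1)\<close>,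
  \<open>(l + k) / (l - 1)\<close>, \<open>(l - k) / (l - 1)\<close> between the pairs, and \<open>2 / (1 + k\<^sup>2)\<close>,
  \<open>2 / (l\<^sup>2 - 1)\<close> within the pairs. The identity \<open>(l + k) * (l - k) = 4\<close> turns them into
  multiples of the reciprocals of the squared distances.
\<close>

lemma canonical_dziobek:
  assumes m: "-1 < m" "m < 1" "m \<noteq> 0" and kl: "k\<^sup>2 = (1 - m) / (1 + m)" "l\<^sup>2 = 4 + k\<^sup>2" and r: "r\<^sup>2 = 3"
    and W: "W = - 2 * (m + 1) / (m * (m + 2))" and "i \<noteq> j"
  shows "1 / (dist (canonical_config k l r i) (canonical_config k l r j))\<^sup>2
     = 1 / (8 * (l\<^sup>2 - 1)) * (1 + W * canonical_weight m k l i * canonical_weight m k l j)"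
proof -
  note nz = canonical_nonzero[OF kl(2)]
  have l1: "l\<^sup>2 - 1 \<noteq> 0" using nz by linarith
  have k1: "k\<^sup>2 + 1 \<noteq> 0" using zero_le_power2[of k] by linarith
  have m1: "m + 1 \<noteq> 0" "m + 2 \<noteq> 0" "1 + m \<noteq> 0" using m by auto
  have mk: "m * (k\<^sup>2 + 1) = 1 - k\<^sup>2" using m1 unfolding kl by (simp add: field_simps)
  have lm: "(l\<^sup>2 - 1) * (m + 1) = 2 * (m + 2)" using kl(2) mk by algebra
  have "W * (m * (m + 2)) = - 2 * (m + 1)" using W m m1 by (simp add: nonzero_eq_divide_eq)
  then have "(m + 1) * (W * m * (l\<^sup>2 - 1) + 4) = 0" using lm by algebra
  then have Wm: "W * m * (l\<^sup>2 - 1) = - 4" using m1 by simp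
  have *: "1 / D = 1 / (8 * (l\<^sup>2 - 1)) * z" if "z * D = 8 * (l\<^sup>2 - 1)" for z D
  proof -
    have "z \<noteq> 0" "D \<noteq> 0" using that l1 by auto
    then show ?thesis using that l1 by (simp add: divide_simps)
  qed
  let ?d = "\<lambda>i j. (dist (canonical_config k l r i) (canonical_config k l r j))\<^sup>2"
  let ?z = "\<lambda>i j. 1 + W * canonical_weight m k l i * canonical_weight m k l j"
  have g: "(l + 1) * ?z 1 3 = l - k" "(l + 1) * ?z 1 4 = l + k" "(l - 1) * ?z 2 3 = l + k" "(l - 1) * ?z 2 4 = l - k"
  proof -
    have "(l - 1) * (l + 1) * (W * m) = - 4" using Wm by algebra
    then have "(l - 1) * ((l + 1) * ?z 1 3 - (l - k)) = 0" "(l - 1) * ((l + 1) * ?z 1 4 - (l + k)) = 0"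
      "(l + 1) * ((l - 1) * ?z 2 3 - (l + k)) = 0" "(l + 1) * ((l - 1) * ?z 2 4 - (l - k)) = 0"
      unfolding canonical_weight_simps by (simp_all add: field_simps) algebra+
    then show "(l + 1) * ?z 1 3 = l - k" "(l + 1) * ?z 1 4 = l + k" "(l - 1) * ?z 2 3 = l + k" "(l - 1) * ?z 2 4 = l - k"
      using nz by simp_all
  qed
  have "?z 1 2 = 1 - W * m * (l\<^sup>2 - 1) * m / 4"
    unfolding canonical_weight_simps by (simp add: field_simps power2_eq_square)
  then have g12: "?z 1 2 = 1 + m" unfolding Wm by simp
  have "4 * (m * (?z 3 4) * (l\<^sup>2 - 1)) = 4 * m * (l\<^sup>2 - 1) + W * m * (l\<^sup>2 - 1) * (1 - k\<^sup>2)"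
    unfolding canonical_weight_simps by (simp add: field_simps power2_eq_square)
  also have "\<dots> = m * 8" using Wm kl(2) mk by algebra
  finally have g34: "?z 3 4 * (l\<^sup>2 - 1) = 2" using m by (simp add: mult.assoc mult.commute)
  have kl4: "(l + k) * (l - k) = 4" using kl(2) by algebra
  have "?z 1 2 * ?d 1 2 = 8 * (l\<^sup>2 - 1)" "?z 3 4 * ?d 3 4 = 8 * (l\<^sup>2 - 1)"
    "?z 1 3 * ?d 1 3 = 8 * (l\<^sup>2 - 1)" "?z 1 4 * ?d 1 4 = 8 * (l\<^sup>2 - 1)"
    "?z 2 3 * ?d 2 3 = 8 * (l\<^sup>2 - 1)" "?z 2 4 * ?d 2 4 = 8 * (l\<^sup>2 - 1)"
    unfolding canonical_dist[OF kl(2) r] using g g12 g34 kl4 mk by algebra+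
  moreover have "?z i j * ?d i j = ?z j i * ?d j i" for i j
    by (simp add: dist_commute algebra_simps)
  ultimately have "?z i j * ?d i j = 8 * (l\<^sup>2 - 1)"
    using \<open>i \<noteq> j\<close> exhaust_4[of i] exhaust_4[of j] by metis
  then show ?thesis by (rule *)
qed

lemma canonical_equilibrium:
  assumes m: "-1 < m" "m < 1" "m \<noteq> 0" and p: "(k, l, r) \<in> canonical_parameters m"
  shows "relative_equilibrium (two_pair_strengths m) (canonical_config k l r)"
proof -
  have p: "k\<^sup>2 = (1 - m) / (1 + m)" "l\<^sup>2 = 4 + k\<^sup>2" "r\<^sup>2 = 3"
    using p by (auto simp: canonical_parameters_def)
  have "1 / (8 * (l\<^sup>2 - 1)) \<noteq> 0" using canonical_nonzero(1)[OF p(2)] by simp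
  moreover have "(\<Sum>i\<in>UNIV. two_pair_strengths m i) \<noteq> 0" using m by (simp add: sum_4)
  ultimately show ?thesis
    using equilibrium_of_dziobek[OF canonical_inj[OF p(2,3)] _ _ canonical_weight_sums canonical_dziobek[OF m p refl]]
    by blast
qed

section \<open>Lines of symmetry\<close>

lemma line_reflection_isometry:
  assumes "norm u = 1"
  shows "dist (line_reflection p u y) (line_reflection p u z) = dist y z"
    "line_reflection p u (line_reflection p u y) = y"
proof -
  have u: "(u $ 1)\<^sup>2 + (u $ 2)\<^sup>2 = 1"
    using dist_plane[of u 0] assms by simp
  have "(dist (line_reflection p u y) (line_reflection p u z))\<^sup>2 = (dist y z)\<^sup>2"
    unfolding dist_plane line_reflection_def by (simp add: inner_vec_def sum_2) (use u in algebra)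
  then show "dist (line_reflection p u y) (line_reflection p u z) = dist y z"
    by (simp add: power2_eq_iff_nonneg)
  show "line_reflection p u (line_reflection p u y) = y"
    unfolding vec_eq_iff forall_2 line_reflection_def
    by (simp add: inner_vec_def sum_2) (use u in algebra)
qed

text \<open>
  The axis is spanned by the quarter turn of \<open>a - b\<close>; on the right the same map is written in
  terms of the normal \<open>a - b\<close>, which is the form needed to follow the four points.
\<close>

lemma perpendicular_bisector_reflection:
  fixes a b :: "real^2"
  assumes "a \<noteq> b"
  obtains p u where "norm u = 1"
    and "\<And>y. line_reflection p u y
      = y - (2 * ((y - midpoint a b) \<bullet> (a - b)) / ((a - b) \<bullet> (a - b))) *\<^sub>R (a - b)"
proof -
  define N where "N = norm (a - b)"
  define u :: "real^2" where "u = vector [- ((a - b) $ 2) / N, (a - b) $ 1 / N]"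
  have N: "N > 0" using assms by (simp add: N_def)
  have NN: "N\<^sup>2 = ((a - b) $ 1)\<^sup>2 + ((a - b) $ 2)\<^sup>2" 
    using dist_plane[of a b] by (simp add: N_def dist_norm)
  have "(norm u)\<^sup>2 = (((a - b) $ 1)\<^sup>2 + ((a - b) $ 2)\<^sup>2) / N\<^sup>2"
    using dist_plane[of u 0] by (simp add: u_def power_divide add_divide_distrib power2_commute)
  then have "(norm u)\<^sup>2 = 1" unfolding NN[symmetric] using N by simp
  then have "norm u = 1" by (simp add: power2_eq_1_iff) (smt (verit) norm_ge_zero)
  moreover have "line_reflection (midpoint a b) u y
      = y - (2 * ((y - midpoint a b) \<bullet> (a - b)) / ((a - b) \<bullet> (a - b))) *\<^sub>R (a - b)" for y
  proof -
    define z d where "z = y - midpoint a b" and "d = a - b"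
    have dd: "d \<bullet> d = N\<^sup>2" unfolding d_def N_def by (simp add: power2_norm_eq_inner)
    have "N\<^sup>2 * (2 * (z \<bullet> u) * u $ i - z $ i) = N\<^sup>2 * (z $ i) - 2 * (z \<bullet> d) * d $ i" for i
    proof -
      have uc: "u $ 1 = - (d $ 2) / N" "u $ 2 = d $ 1 / N" by (simp_all add: u_def d_def)
      then have "N * u $ 1 = - (d $ 2)" "N * u $ 2 = d $ 1" using N by simp_all
      moreover from this have "N * (z \<bullet> u) = z $ 2 * d $ 1 - z $ 1 * d $ 2"
        unfolding inner_vec_def sum_2 inner_real_def by algebra
      moreover have "z \<bullet> d = z $ 1 * d $ 1 + z $ 2 * d $ 2"
        by (simp add: inner_vec_def sum_2)
      ultimately have "N\<^sup>2 * (2 * (z \<bullet> u) * u $ 1 - z $ 1) = N\<^sup>2 * z $ 1 - 2 * (z \<bullet> d) * d $ 1"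
        "N\<^sup>2 * (2 * (z \<bullet> u) * u $ 2 - z $ 2) = N\<^sup>2 * z $ 2 - 2 * (z \<bullet> d) * d $ 2"
        using NN[folded d_def] by algebra+
      then show ?thesis using exhaust_2[of i] by auto
    qed
    then have "2 * (z \<bullet> u) * u $ i - z $ i = z $ i - 2 * (z \<bullet> d) / N\<^sup>2 * d $ i" for i
      using N by (simp add: field_simps)
    then show ?thesis
      unfolding line_reflection_def z_def[symmetric] d_def[symmetric] dd
      by (simp add: vec_eq_iff z_def algebra_simps)
  qed
  ultimately show ?thesis using that by blast
qed

text \<open>
  The reflection in the perpendicular bisector exchanges \<open>x i\<close> and \<open>x j\<close>, so only the
  other two points matter. The premise carries the explicit formula of that reflection.
\<close>

lemma bisector_reflection_symmetry:
  fixes x :: config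
  assumes ne: "x i \<noteq> x j" and U: "UNIV = {i, j, k, l}"
    and kl: "\<And>p u. (\<And>y. line_reflection p u y
        = y - ((2 * (y \<bullet> (x i - x j)) - (x i + x j) \<bullet> (x i - x j)) / ((x i - x j) \<bullet> (x i - x j))) *\<^sub>R (x i - x j))
      \<Longrightarrow> line_reflection p u ` {x k, x l} = {x k, x l}"
  shows "\<not> asymmetric x"
proof -
  define d where "d = x i - x j"
  have d0: "d \<bullet> d \<noteq> 0" using ne by (simp add: d_def)
  have half: "2 * ((y - midpoint (x i) (x j)) \<bullet> d) = 2 * (y \<bullet> d) - (x i + x j) \<bullet> d" for y
    by (simp add: midpoint_def inner_diff_left)
  obtain p u where u: "norm u = 1" and "\<And>y. line_reflection p u y
      = y - (2 * ((y - midpoint (x i) (x j)) \<bullet> d) / (d \<bullet> d)) *\<^sub>R d"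
    unfolding d_def using perpendicular_bisector_reflection[OF ne] by metis
  then have ref: "line_reflection p u y = y - ((2 * (y \<bullet> d) - (x i + x j) \<bullet> d) / (d \<bullet> d)) *\<^sub>R d" for y
    unfolding half by simp
  have "2 * (x i \<bullet> d) - (x i + x j) \<bullet> d = d \<bullet> d" "2 * (x j \<bullet> d) - (x i + x j) \<bullet> d = - (d \<bullet> d)"
    by (simp_all add: d_def algebra_simps inner_commute)
  then have "line_reflection p u (x i) = x j" "line_reflection p u (x j) = x i"
    unfolding ref using d0 by (simp_all add: d_def)
  moreover have "line_reflection p u ` {x k, x l} = {x k, x l}"
    using ref unfolding d_def by (rule kl)
  ultimately have "line_reflection p u ` range x = range x"
    unfolding U by (simp add: insert_commute)
  with u show ?thesis unfolding asymmetric_def by blast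
qed

text \<open>
  Points equidistant from \<open>x i\<close> and \<open>x j\<close> are fixed by the reflection.
\<close>

lemma kite_not_asymmetric:
  fixes x :: config
  assumes ne: "x i \<noteq> x j" and U: "UNIV = {i, j, k, l}"
    and eq: "dist (x i) (x k) = dist (x j) (x k)" "dist (x i) (x l) = dist (x j) (x l)"
  shows "\<not> asymmetric x"
proof (rule bisector_reflection_symmetry[OF ne U])
  fix p u assume ref: "\<And>y. line_reflection p u y
    = y - ((2 * (y \<bullet> (x i - x j)) - (x i + x j) \<bullet> (x i - x j)) / ((x i - x j) \<bullet> (x i - x j))) *\<^sub>R (x i - x j)"
  have "2 * (y \<bullet> (x i - x j)) - (x i + x j) \<bullet> (x i - x j) = 0" if "dist (x i) y = dist (x j) y" for y
  proof -
    have "(dist (x i) y)\<^sup>2 = (dist (x j) y)\<^sup>2" using that by simp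
    then show ?thesis unfolding dist_norm power2_norm_eq_inner
      by (simp add: algebra_simps inner_commute)
  qed
  then show "line_reflection p u ` {x k, x l} = {x k, x l}"
    unfolding image_insert ref using eq by simp
qed

text \<open>
  The two distance conditions together say that the midpoint of \<open>x k\<close>, \<open>x l\<close> lies on the
  perpendicular bisector of \<open>x i\<close>, \<open>x j\<close>, so for parallel segments the reflection exchanges
  \<open>x k\<close> and \<open>x l\<close>.
\<close>

lemma trapezoid_not_asymmetric:
  fixes x :: config
  assumes ne: "x i \<noteq> x j" and U: "UNIV = {i, j, k, l}"
    and par: "x k - x l = c *\<^sub>R (x i - x j)"
    and eq: "dist (x i) (x k) = dist (x j) (x l)" "dist (x i) (x l) = dist (x j) (x k)"
  shows "\<not> asymmetric x"
proof (rule bisector_reflection_symmetry[OF ne U])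
  define d where "d = x i - x j"
  have d0: "d \<bullet> d \<noteq> 0" using ne by (simp add: d_def)
  fix p u assume "\<And>y. line_reflection p u y
    = y - ((2 * (y \<bullet> (x i - x j)) - (x i + x j) \<bullet> (x i - x j)) / ((x i - x j) \<bullet> (x i - x j))) *\<^sub>R (x i - x j)"
  note ref = this[folded d_def]
  have "(dist (x i) (x k))\<^sup>2 = (dist (x j) (x l))\<^sup>2" "(dist (x i) (x l))\<^sup>2 = (dist (x j) (x k))\<^sup>2"
    using eq by simp_all
  then have "(x k + x l) \<bullet> d = (x i + x j) \<bullet> d"
    unfolding dist_norm power2_norm_eq_inner by (simp add: d_def algebra_simps inner_commute)
  moreover have "x k \<bullet> d - x l \<bullet> d = c * (d \<bullet> d)"
    using par by (metis d_def inner_diff_left inner_scaleR_left)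
  ultimately have "2 * (x k \<bullet> d) - (x i + x j) \<bullet> d = c * (d \<bullet> d)"
    "2 * (x l \<bullet> d) - (x i + x j) \<bullet> d = - c * (d \<bullet> d)"
    by (simp_all add: inner_add_left)
  note hkl = this
  have "x k = x l + c *\<^sub>R d" using par by (simp add: d_def algebra_simps)
  then have "line_reflection p u (x k) = x l" "line_reflection p u (x l) = x k"
    unfolding ref hkl using d0 by simp_all
  then show "line_reflection p u ` {x k, x l} = {x k, x l}" by auto
qed

section \<open>Asymmetry of the explicit configurations\<close>

lemma collinear_plane_det:
  fixes a b c :: "real^2"
  assumes "collinear S" "a \<in> S" "b \<in> S" "c \<in> S"
  shows "(b $ 1 - a $ 1) * (c $ 2 - a $ 2) = (b $ 2 - a $ 2) * (c $ 1 - a $ 1)"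
proof -
  obtain u s t where "b - a = s *\<^sub>R u" "c - a = t *\<^sub>R u"
    using assms unfolding collinear_def by metis
  then have "b $ 1 - a $ 1 = s * u $ 1" "b $ 2 - a $ 2 = s * u $ 2"
    "c $ 1 - a $ 1 = t * u $ 1" "c $ 2 - a $ 2 = t * u $ 2"
    by (simp_all add: vec_eq_iff flip: vector_minus_component)
  then show ?thesis by algebra
qed

lemma canonical_strictly_planar:
  assumes "l\<^sup>2 = 4 + k\<^sup>2" "r\<^sup>2 = 3"
  shows "strictly_planar (canonical_config k l r)"
  unfolding strictly_planar_def
proof
  assume c: "collinear (range (canonical_config k l r))"
  have "2 * (l\<^sup>2 - 1) * ((l + 1) * r) = 0"
    using collinear_plane_det[OF c rangeI[of _ 3] rangeI[of _ 4] rangeI[of _ 1]]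
    by (simp add: canonical_config_simps)
  moreover have "r \<noteq> 0" using assms(2) by auto
  ultimately show False using canonical_nonzero(1,2)[OF assms(1)] by simp
qed

text \<open>
  A reflection that preserves the set of points induces an involution \<open>f\<close> of the labels that
  preserves distances, and \<open>f\<close> is not the identity because the points are not collinear. Each
  of the nine remaining involutions would force two distances to coincide that differ when \<open>k \<noteq> 0\<close> and
  \<open>k\<^sup>2 \<noteq> 1\<close>.
\<close>

lemma canonical_asymmetric:
  assumes l: "l\<^sup>2 = 4 + k\<^sup>2" and r: "r\<^sup>2 = 3" and k: "k \<noteq> 0" "k\<^sup>2 \<noteq> 1"
  shows "asymmetric (canonical_config k l r)"
  unfolding asymmetric_def
proof clarify
  fix p u :: "real^2" assume u: "norm u = 1"
  let ?C = "canonical_config k l r"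
  assume im: "line_reflection p u ` range ?C = range ?C"
  have "\<exists>j. line_reflection p u (?C i) = ?C j" for i
    using im by blast
  then obtain f where f: "\<And>i. line_reflection p u (?C i) = ?C (f i)" by metis
  note inj = canonical_inj[OF l r]
  have ff: "f (f i) = i" for i
    using line_reflection_isometry(2)[OF u, of p "?C i"] inj unfolding f by (simp add: inj_eq)
  define d where "d i j = (dist (?C i) (?C j))\<^sup>2" for i j
  have df: "d (f i) (f j) = d i j" for i j
    using line_reflection_isometry(1)[OF u, of p "?C i" "?C j"] unfolding f d_def by simp
  have sym: "d i j = d j i" for i j by (simp add: d_def dist_commute)
  have "\<exists>i. f i \<noteq> i"
  proof (rule ccontr)
    assume "\<not> ?thesis"
    then have "line_reflection p u (?C i) = ?C i" for i using f by simp
    then have "?C i = p + ((?C i - p) \<bullet> u) *\<^sub>R u" for i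
    proof -
      have "2 *\<^sub>R ((?C i - p) - ((?C i - p) \<bullet> u) *\<^sub>R u) = 0"
        using \<open>\<And>i. line_reflection p u (?C i) = ?C i\<close>[of i] unfolding line_reflection_def
        by (simp add: algebra_simps scaleR_2)
      then have "(?C i - p) - ((?C i - p) \<bullet> u) *\<^sub>R u = 0"
        unfolding scaleR_eq_0_iff by simp
      then show ?thesis by (simp add: algebra_simps)
    qed
    then have "collinear (range ?C)" unfolding collinear_alt by blast
    then show False using canonical_strictly_planar[OF l r] by (simp add: strictly_planar_def)
  qed
  note d = canonical_dist[OF l r, folded d_def]
  note nz = canonical_nonzero[OF l]
  have l1: "l\<^sup>2 - 1 \<noteq> 0" using nz by linarith
  have l0: "l \<noteq> 0" using nz(1) by auto
  have l2: "l\<noteq> 2" "l \<noteq> -2" using l k by auto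
  have k1: "k + 1 \<noteq> 0" "k - 1 \<noteq> 0" using k(2) by (auto simp: eq_neg_iff_add_eq_0[symmetric])
  have D12: "d 1 3 \<noteq> d 2 3"
  proof
    assume "d 1 3 = d 2 3"
    then have "(l\<^sup>2 - 1) * (l * (k + 1)) = 0" unfolding d by algebra
    then show False using l1 l0 k1 by simp
  qed
  have D34: "d 1 3 \<noteq> d 1 4"
  proof
    assume "d 1 3 = d 1 4"
    then have "(l\<^sup>2 - 1) * ((l + 1) * k) = 0" unfolding d by algebra
    then show False using l1 nz k by simp
  qed
  have D13: "d 1 4 \<noteq> d 3 4"
  proof
    assume "d 1 4 = d 3 4"
    then have "(l\<^sup>2 - 1) * ((l + 1) * (l - 2 + k)) = 0" unfolding d by algebra
    then have "k = 2 - l" using l1 nz by simp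
    then have "8 - 4 * l = 0" using l by algebra
    then show False using l2 by simp
  qed
  have D14: "d 1 3 \<noteq> d 3 4"
  proof
    assume "d 1 3 = d 3 4"
    then have "(l\<^sup>2 - 1) * ((l + 1) * (l - 2 - k)) = 0" unfolding d by algebra
    then have "k = l - 2" using l1 nz by simp
    then have "8 - 4 * l = 0" using l by algebra
    then show False using l2 by simp
  qed
  have D23: "d 2 4 \<noteq> d 3 4"
  proof
    assume "d 2 4 = d 3 4"
    then have "(l\<^sup>2 - 1) * ((l - 1) * (l + 2 - k)) = 0" unfolding d by algebra
    then have "k = l + 2" using l1 nz by simp
    then have "8 + 4 * l = 0" using l by algebra
    then show False using l2 by simp
  qed
  have D24: "d 2 3 \<noteq> d 3 4"
  proof
    assume "d 2 3 = d 3 4"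
    then have "(l\<^sup>2 - 1) * ((l - 1) * (l + 2 + k)) = 0" unfolding d by algebra
    then have "k = - l - 2" using l1 nz by simp
    then have "8 + 4 * l = 0" using l by algebra
    then show False using l2 by simp
  qed
  have DD: "d 1 3 \<noteq> d 2 4"
  proof
    assume "d 1 3 = d 2 4"
    then have "(l\<^sup>2 - 1) * (l + k) = 0" unfolding d by algebra
    then show False using l1 nz by simp
  qed
  have DE: "d 1 2 \<noteq> d 3 4"
  proof
    assume "d 1 2 = d 3 4"
    then have "l\<^sup>2 - 1 = 0" unfolding d using l by algebra
    then show False using l1 by simp
  qed
  have E: "f i = 1 \<or> f i = 2 \<or> f i = 3 \<or> f i = 4" for i by (rule exhaust_4)
  have df': "d (f 1) (f 3) = d 1 3" "d (f 1) (f 4) = d 1 4" "d (f 2) (f 3) = d 2 3"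
     "d (f 2) (f 4) = d 2 4" "d (f 3) (f 4) = d 3 4" "d (f 1) (f 2) = d 1 2"
    by (rule df)+
  have ff': "f (f 1) = 1" "f (f 2) = 2" "f (f 3) = 3" "f (f 4) = 4" by (rule ff)+
  have sym': "d 2 1 = d 1 2" "d 3 1 = d 1 3" "d 4 1 = d 1 4" "d 3 2 = d 2 3" "d 4 2 = d 2 4" "d 4 3 = d 3 4"
    by (rule sym)+
  have "f 1 = 1 \<and> f 2 = 2 \<and> f 3 = 3 \<and> f 4 = 4"
    using E[of 1]
  proof (elim disjE)
    assume f1: "f 1 = 1"
    show ?thesis using E[of 2]
    proof (elim disjE)
      assume f2: "f 2 = 2"
      have "f 3 \<noteq> 4" using D34 df'(1) f1 by auto
      then have "f 3 = 3" using E[of 3] f1 f2 ff'(3) by auto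
      then show ?thesis using E[of 4] f1 f2 ff'(4) by auto
    next
      assume f2: "f 2 = 3"
      then have "f 3 = 2" using ff'(2) by simp
      then have "f 4 = 4" using E[of 4] f1 f2 ff'(4) by auto
      then have False using df' f1 f2 \<open>f 3 = 2\<close> D23 by auto
      then show ?thesis ..
    next
      assume f2: "f 2 = 4"
      then have "f 4 = 2" using ff'(2) by simp
      then have "f 3 = 3" using E[of 3] f1 f2 ff'(3) by auto
      then have False using df' f1 f2 \<open>f 4 = 2\<close> D24 sym' by auto
      then show ?thesis ..
    qed (use f1 ff' in auto)
  next
    assume f1: "f 1 = 2"
    then have f2: "f 2 = 1" using ff'(1) by simp
    have "f 3 = 3 \<or> f 3 = 4" using E[of 3] ff'(3) f1 f2 by auto
    then have False using df' f1 f2 D12 DD by auto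
    then show ?thesis ..
  next
    assume f1: "f 1 = 3"
    then have f3: "f 3 = 1" using ff'(1) by simp
    have "f 4 = 4 \<or> f 4 = 2" using E[of 4] ff'(4) f1 f3 by auto
    then have False
    proof
      assume "f 4 = 4" then show False using df' f1 f3 D13 by auto
    next
      assume "f 4 = 2" then have "f 2 = 4" using ff' by auto
      then show False using df' f1 DE by auto
    qed
    then show ?thesis ..
  next
    assume f1: "f 1 = 4"
    then have f4: "f 4 = 1" using ff'(1) by simp
    have "f 3 = 3 \<or> f 3 = 2" using E[of 3] ff'(3) f1 f4 by auto
    then have False
    proof
      assume "f 3 = 3" then show False using df' f1 f4 D14 sym' by auto
    next
      assume "f 3 = 2" then have "f 2 = 3" using ff' by auto
      then show False using df' f1 DE sym' by auto
    qed
    then show ?thesis ..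
  qed
  then have "f i = i" for i using exhaust_4[of i] by auto
  then show False using \<open>\<exists>i. f i \<noteq> i\<close> by simp
qed

section \<open>Convexity and concavity from the signs of a dependency\<close>

lemma four_labels:
  fixes i :: 4
  obtains j k l where "UNIV = {i, j, k, l}" "i \<noteq> j" "i \<noteq> k" "i \<noteq> l" "j \<noteq> k" "j \<noteq> l" "k \<noteq> l"
  using exhaust_4[of i]
proof (elim disjE)
  assume "i = 1" then show ?thesis using that[of 2 3 4] UNIV_4 by simp
next
  assume "i = 2" then show ?thesis using that[of 1 3 4] UNIV_4 by (simp add: insert_commute)
next
  assume "i = 3" then show ?thesis using that[of 1 2 4] UNIV_4 by (simp add: insert_commute)
next
  assume "i = 4" then show ?thesis using that[of 1 2 3] UNIV_4 by (simp add: insert_commute)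
qed

lemma dependency_unique:
  fixes x :: config
  assumes "inj x" "\<not> collinear (range x)" "w i \<noteq> 0"
    and "(\<Sum>i\<in>UNIV. w i) = 0" "(\<Sum>i\<in>UNIV. w i *\<^sub>R x i) = 0"
    and "(\<Sum>i\<in>UNIV. z i) = 0" "(\<Sum>i\<in>UNIV. z i *\<^sub>R x i) = 0"
  shows "\<exists>e. \<forall>i. z i = e * w i"
proof -
  obtain v where v: "\<And>z. (\<Sum>i\<in>UNIV. z i) = 0 \<Longrightarrow> (\<Sum>i\<in>UNIV. z i *\<^sub>R x i) = 0 \<Longrightarrow> \<exists>c. \<forall>i. z i = c * v i"
    by (rule planar_dependencies[OF assms(1,2)]) blast
  obtain c where c: "\<forall>i. w i = c * v i" using v assms(4,5) by blast
  obtain c' where c': "\<forall>i. z i = c' * v i" using v assms(6,7) by blast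
  have "c \<noteq> 0" using c assms(3) by auto
  then have "\<forall>i. z i = c' / c * w i" using c c' by simp
  then show ?thesis by blast
qed

lemma no_three_collinear_of_dependency:
  fixes x :: config
  assumes inj: "inj x" and nc: "\<not> collinear (range x)" and w: "\<And>i. w i \<noteq> 0"
    and w0: "(\<Sum>i\<in>UNIV. w i) = 0" "(\<Sum>i\<in>UNIV. w i *\<^sub>R x i) = 0"
  shows "no_three_collinear x"
  unfolding no_three_collinear_def
proof (intro allI impI notI)
  fix a b c :: 4 assume ne: "a \<noteq> b \<and> a \<noteq> c \<and> b \<noteq> c" and col: "collinear {x a, x b, x c}"
  have "{a, b, c} \<noteq> UNIV"
  proof
    assume "{a, b, c} = UNIV"
    then have "card {a, b, c} = 4" by simp
    then show False using ne by simp
  qed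
  then obtain l where l: "l \<noteq> a" "l \<noteq> b" "l \<noteq> c" by blast
  have "card {l, a, b, c} = card (UNIV :: 4 set)" using ne l by simp
  then have U: "UNIV = {l, a, b, c}" using card_subset_eq[of UNIV "{l, a, b, c}"] by simp
  have S: "sum f UNIV = f l + f a + f b + f c" for f :: "4 \<Rightarrow> 'b::comm_monoid_add"
    unfolding U using ne l by (simp add: ac_simps)
  obtain u s t where st: "x b - x a = s *\<^sub>R u" "x c - x a = t *\<^sub>R u"
    using col unfolding collinear_def by (meson insertI1 insertI2)
  have "w l *\<^sub>R (x l - x a) = - (w b *\<^sub>R (x b - x a) + w c *\<^sub>R (x c - x a))"
  proof -
    have "w l *\<^sub>R x l + w a *\<^sub>R x a + w b *\<^sub>R x b + w c *\<^sub>R x c - (w l + w a + w b + w c) *\<^sub>R x a = 0"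
      using w0 unfolding S by simp
    then show ?thesis by (simp add: algebra_simps add_eq_0_iff eq_neg_iff_add_eq_0)
  qed
  then have "w l *\<^sub>R (x l - x a) = (- (w b * s + w c * t)) *\<^sub>R u"
    unfolding st by (simp add: algebra_simps)
  then have "(1 / w l) *\<^sub>R w l *\<^sub>R (x l - x a) = (1 / w l) *\<^sub>R (- (w b * s + w c * t)) *\<^sub>R u"
    by simp
  then have lu: "x l - x a = (- (w b * s + w c * t) / w l) *\<^sub>R u" using w[of l] by simp
  have "\<exists>e. x i = x a + e *\<^sub>R u" for i
  proof -
    have "i = l \<or> i = a \<or> i = b \<or> i = c" using U by blast
    then have "\<exists>e. x i - x a = e *\<^sub>R u"
      using lu st by (metis cancel_comm_monoid_add_class.diff_cancel scaleR_zero_left)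
    then show ?thesis by (metis add.commute diff_add_cancel)
  qed
  then have "collinear (range x)" unfolding collinear_alt by blast
  with nc show False ..
qed

text \<open>
  A point in the hull of the others gives a dependency with exactly one negative coefficient.
  It is proportional to \<open>w\<close>, in which no coefficient is alone with its sign.
\<close>

lemma convex_of_dependency:
  fixes x :: config
  assumes inj: "inj x" and nc: "\<not> collinear (range x)" and w: "\<And>i. w i \<noteq> 0"
    and w0: "(\<Sum>i\<in>UNIV. w i) = 0" "(\<Sum>i\<in>UNIV. w i *\<^sub>R x i) = 0"
    and pair: "\<And>i. \<exists>j. j \<noteq> i \<and> w i * w j > 0"
  shows "convex_config x"
  unfolding convex_config_def
proof (intro conjI allI notI)
  show "no_three_collinear x" by (rule no_three_collinear_of_dependency) fact+
  fix i assume "x i \<in> convex hull (x ` (UNIV - {i}))"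
  then obtain u where u: "\<forall>y\<in>x ` (UNIV - {i}). 0 \<le> u y" "sum u (x ` (UNIV - {i})) = 1"
    "(\<Sum>y\<in>x ` (UNIV - {i}). u y *\<^sub>R y) = x i"
    by (auto simp: convex_hull_finite)
  define z where "z j = (if j = i then -1 else u (x j))" for j
  have inj': "inj_on x (UNIV - {i})" using inj inj_on_subset by blast
  have "(\<Sum>j\<in>UNIV. z j) = z i + (\<Sum>j\<in>UNIV - {i}. u (x j))"
    by (simp add: sum.remove[of UNIV i] z_def)
  also have "\<dots> = 0" using u(2) by (simp add: sum.reindex[OF inj'] z_def)
  finally have z0: "(\<Sum>j\<in>UNIV. z j) = 0" .
  have "(\<Sum>j\<in>UNIV. z j *\<^sub>R x j) = z i *\<^sub>R x i + (\<Sum>j\<in>UNIV - {i}. u (x j) *\<^sub>R x j)"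
    by (simp add: sum.remove[of UNIV i] z_def)
  also have "\<dots> = 0" using u(3) by (simp add: sum.reindex[OF inj'] z_def)
  finally obtain e where e: "\<And>i. z i = e * w i"
    using dependency_unique[OF inj nc w w0 z0] by blast
  obtain j where j: "j \<noteq> i" "w i * w j > 0" using pair by blast
  have "z j \<ge> 0" using j(1) u(1) by (simp add: z_def)
  then have "z i * z j \<le> 0" by (simp add: z_def)
  moreover have "z i * z j = e\<^sup>2 * (w i * w j)" by (simp add: e power2_eq_square)
  moreover have "e \<noteq> 0" using e[of i] by (auto simp: z_def)
  ultimately show False using j(2) by (smt (verit) mult_pos_pos zero_less_power2)
qed

text \<open>
  Solving the dependency for \<open>x i\<close> writes it with positive barycentric coordinates.
\<close>

lemma concave_of_dependency:
  fixes x :: config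
  assumes inj: "inj x" and nc: "\<not> collinear (range x)" and w: "\<And>i. w i \<noteq> 0"
    and w0: "(\<Sum>i\<in>UNIV. w i) = 0" "(\<Sum>i\<in>UNIV. w i *\<^sub>R x i) = 0"
    and opp: "\<And>j. j \<noteq> i \<Longrightarrow> w i * w j < 0"
  shows "concave_config x"
  unfolding concave_config_def
proof (intro conjI exI[of _ i])
  show n3: "no_three_collinear x" by (rule no_three_collinear_of_dependency) fact+
  obtain j k l where U: "UNIV = {i, j, k, l}" and ne: "i \<noteq> j" "i \<noteq> k" "i \<noteq> l" "j \<noteq> k" "j \<noteq> l" "k \<noteq> l"
    by (rule four_labels)
  have S: "sum f UNIV = f i + f j + f k + f l" for f :: "4 \<Rightarrow> 'b::comm_monoid_add"
    unfolding U using ne by (simp add: ac_simps)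
  have im: "x ` (UNIV - {i}) = {x j, x k, x l}" unfolding U using ne by auto
  have ncol: "\<not> collinear {x j, x k, x l}" using n3 ne unfolding no_three_collinear_def by blast
  have pos: "- w a / w i > 0" if "a \<noteq> i" for a
    using opp[OF that] w[of i] by (auto simp: mult_less_0_iff divide_less_0_iff)
  have "- w j / w i + - w k / w i + - w l / w i = 1"
  proof -
    have "w i = - w j + - w k + - w l" using w0(1) unfolding S by simp
    then have "(- w j + - w k + - w l) / w i = 1" using w[of i] by simp
    then show ?thesis by (simp only: add_divide_distrib)
  qed
  moreover have "(- w j / w i) *\<^sub>R x j + (- w k / w i) *\<^sub>R x k + (- w l / w i) *\<^sub>R x l = x i"
  proof -
    have "x i = (1 / w i) *\<^sub>R (w i *\<^sub>R x i)" using w by simp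
    also have "w i *\<^sub>R x i = - (w j *\<^sub>R x j + w k *\<^sub>R x k + w l *\<^sub>R x l)"
      using w0(2) unfolding S add.assoc by (rule eq_neg_iff_add_eq_0[THEN iffD2])
    finally show ?thesis by (simp add: scaleR_add_right scaleR_diff_right)
  qed
  moreover have dim: "DIM(real^2) = 2" by simp
  ultimately show "x i \<in> interior (convex hull (x ` (UNIV - {i})))"
    unfolding im interior_convex_hull_3_minimal[OF ncol dim] mem_Collect_eq
    using pos[of j] pos[of k] pos[of l] ne
    by (intro exI[of _ "- w j / w i"] exI[of _ "- w k / w i"] exI[of _ "- w l / w i"]) auto
qed

text \<open>
  A similarity is affine, so \<open>x\<close> has the affine dependency of the explicit configuration. There
  \<open>w 1 * w 2\<close> is a negative multiple of \<open>l\<^sup>2 - 1\<close>, and \<open>w 3 * w 4\<close> a positive multiple of \<open>1 - k\<^sup>2\<close>,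
  which has the sign of \<open>m\<close>.
\<close>

lemma shape_of_similar_to_canonical:
  assumes m: "-1 < m" "m < 1" "m \<noteq> 0" and kl: "k\<^sup>2 = (1 - m) / (1 + m)" "l\<^sup>2 = 4 + k\<^sup>2"
    and sim: "(canonical_config k l r, x) \<in> direct_similar"
    and x: "inj x" "\<not> collinear (range x)"
  shows "(m < 0 \<longrightarrow> convex_config x) \<and> (m > 0 \<longrightarrow> concave_config x)"
proof -
  define w where "w i = two_pair_strengths m i * canonical_weight m k l i" for i
  have w4: "w 1 = m * (l - 1) / 2" "w 2 = - (m * (l + 1) / 2)"
    "w 3 = m * (1 + k) / 2" "w 4 = m * (1 - k) / 2"
    by (simp_all add: w_def canonical_weight_simps)
  obtain s A v where y: "\<And>i. x i = s *\<^sub>R (A *v canonical_config k l r i) + v"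
    using sim unfolding direct_similar_def by blast
  have s0: "(\<Sum>i\<in>UNIV. w i) = 0" and "(\<Sum>i\<in>UNIV. w i *\<^sub>R canonical_config k l r i) = 0"
    unfolding w_def by (rule canonical_weight_sums)+
  moreover have "(\<Sum>i\<in>UNIV. w i *\<^sub>R x i)
    = s *\<^sub>R (A *v (\<Sum>i\<in>UNIV. w i *\<^sub>R canonical_config k l r i)) + (\<Sum>i\<in>UNIV. w i) *\<^sub>R v"
    unfolding y scaleR_add_right sum.distrib scaleR_left.sum
    by (simp add: sum_4 matrix_vector_right_distrib matrix_vector_mult_scaleR scaleR_add_right mult.commute)
  ultimately have s1: "(\<Sum>i\<in>UNIV. w i *\<^sub>R x i) = 0" by simp
  note nz = canonical_nonzero[OF kl(2)]
  have k1: "1 - k\<^sup>2 = 2 * m / (1 + m)" using m unfolding kl by (simp add: field_simps)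
  have "w 1 * w 2 = m\<^sup>2 * (1 - l\<^sup>2) / 4"
    unfolding w4 by (simp add: field_simps power2_eq_square)
  moreover have "m\<^sup>2 * (1 - l\<^sup>2) < 0" using nz(1) m by (intro mult_pos_neg) simp_all
  ultimately have w12: "w 1 * w 2 < 0" by simp
  have w34: "w 3 * w 4 = m\<^sup>2 * (2 * m / (1 + m)) / 4"
    unfolding w4 k1[symmetric] by (simp add: field_simps power2_eq_square)
  then have "w 3 * w 4 \<noteq> 0" using m by simp
  then have w: "w i \<noteq> 0" for i using exhaust_4[of i] w12 by auto
  have "convex_config x" if "m < 0"
  proof (rule convex_of_dependency[OF x w s0 s1])
    have "2 * m / (1 + m) < 0" using m that by (simp add: divide_neg_pos)
    then have "m\<^sup>2 * (2 * m / (1 + m)) < 0" using m by (intro mult_pos_neg) simp_all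
    then have w34': "w 3 * w 4 < 0" unfolding w34 by (intro divide_neg_pos) simp_all
    (* Both pairs of weights have opposite signs, so each index has a partner in the other pair. *)
    have *: "a * c > 0 \<or> a * d > 0" if "c * d < 0" "a \<noteq> 0" for a c d :: real
      using that by (auto simp: mult_less_0_iff zero_less_mult_iff)
    show "\<exists>j. j \<noteq> i \<and> w i * w j > 0" for i
    proof -
      have "i = 1 \<or> i = 2 \<or> i = 3 \<or> i = 4" by (rule exhaust_4)
      then show ?thesis
        using *[OF w12 w[of i]] *[OF w34' w[of i]] by (metis labels_distinct)
    qed
  qed
  moreover have "concave_config x" if "m > 0"
  proof -
    have "w 3 * w 4 > 0" unfolding w34 using m that by (intro divide_pos_pos mult_pos_pos) simp_all
    moreover have "w 3 + w 4 = m" unfolding w4 by (simp add: algebra_simps add_divide_distrib[symmetric])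
    ultimately have p: "w 3 > 0" "w 4 > 0" using that by (auto simp: zero_less_mult_iff)
    have "\<exists>i. \<forall>j. j \<noteq> i \<longrightarrow> w i * w j < 0"
    proof (cases "w 1 < 0")
      case True
      then have "\<forall>j. j \<noteq> 1 \<longrightarrow> w 1 * w j < 0"
        using w12 p unfolding forall_4 by (auto simp: mult_neg_pos)
      then show ?thesis ..
    next
      case False
      then have "w 1 > 0" "w 2 < 0" using w12 w[of 1] by (auto simp: mult_less_0_iff)
      then have "\<forall>j. j \<noteq> 2 \<longrightarrow> w 2 * w j < 0"
        using p unfolding forall_4 by (auto simp: mult_neg_pos)
      then show ?thesis ..
    qed
    then show ?thesis using concave_of_dependency[OF x w s0 s1] by blast
  qed
  ultimately show ?thesis by blast
qed

section \<open>Similarity of configurations\<close>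

text \<open>
  Stated for any group \<open>P\<close> of orthogonal matrices, so that it covers both relations.
\<close>

lemma similarity_equiv:
  fixes P :: "real^2^2 \<Rightarrow> bool"
  assumes orth: "\<And>A. P A \<Longrightarrow> orthogonal_matrix A" and one: "P (mat 1)"
    and inv: "\<And>A. P A \<Longrightarrow> P (transpose A)" and mul: "\<And>A B. P A \<Longrightarrow> P B \<Longrightarrow> P (A ** B)"
  shows "equiv UNIV {(x :: config, y). \<exists>s A v. s > 0 \<and> P A \<and> (\<forall>i. y i = s *\<^sub>R (A *v x i) + v)}"
    (is "equiv UNIV ?R")
proof (rule equivI)
  show "refl_on UNIV ?R"
  proof (rule refl_onI)
    fix x :: config
    have "\<forall>i. x i = 1 *\<^sub>R (mat 1 *v x i) + 0" by simp
    then show "(x, x) \<in> ?R" using one zero_less_one by blast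
  qed
  show "sym ?R"
  proof (rule symI)
    fix x y :: config assume "(x, y) \<in> ?R"
    then obtain s A v where s: "s > 0" "P A" and y: "\<And>i. y i = s *\<^sub>R (A *v x i) + v" by blast
    have "x i = (1 / s) *\<^sub>R (transpose A *v y i) + - ((1 / s) *\<^sub>R (transpose A *v v))" for i
    proof -
      have "transpose A *v (A *v x i) = x i"
        using orth[OF s(2)] by (simp add: orthogonal_matrix_def matrix_vector_mul_assoc)
      then show ?thesis
        using s(1) unfolding y by (simp add: matrix_vector_right_distrib matrix_vector_mult_scaleR scaleR_add_right)
    qed
    moreover have "1 / s > 0" using s by simp
    ultimately show "(y, x) \<in> ?R" using inv[OF s(2)] by blast
  qed
  show "trans ?R"
  proof (rule transI)
    fix x y z :: config assume "(x, y) \<in> ?R" "(y, z) \<in> ?R"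
    then obtain s A v s' A' v' where s: "s > 0" "P A" "s' > 0" "P A'"
      and y: "\<And>i. y i = s *\<^sub>R (A *v x i) + v" and z: "\<And>i. z i = s' *\<^sub>R (A' *v y i) + v'" by blast
    have "z i = (s' * s) *\<^sub>R ((A' ** A) *v x i) + (s' *\<^sub>R (A' *v v) + v')" for i
      unfolding z y by (simp add: matrix_vector_right_distrib matrix_vector_mult_scaleR scaleR_add_right matrix_vector_mul_assoc)
    moreover have "s' * s > 0" using s by simp
    ultimately show "(x, z) \<in> ?R" using mul[OF s(4,2)] by blast
  qed
qed simp

lemma equiv_similar: "equiv UNIV similar"
  unfolding similar_def by (rule similarity_equiv) (auto simp: orthogonal_matrix_id orthogonal_matrix_mul)

lemma equiv_direct_similar: "equiv UNIV direct_similar"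
  unfolding direct_similar_def
  by (rule similarity_equiv)
     (auto simp: rotation_matrix_def orthogonal_matrix_id orthogonal_matrix_mul det_mul)

lemma direct_similar_imp_similar: "(x, y) \<in> direct_similar \<Longrightarrow> (x, y) \<in> similar"
  unfolding direct_similar_def similar_def rotation_matrix_def by blast

lemma orthogonal_matrix_norm:
  assumes "orthogonal_matrix (A :: real^2^2)"
  shows "norm (A *v v) = norm v"
  using assms orthogonal_transformation_matrix[of "(*v) A"] orthogonal_transformation_norm[of "(*v) A"]
  by simp

lemma similar_dist:
  assumes "(x, y) \<in> similar"
  obtains s where "s > 0" "\<And>i j. dist (y i) (y j) = s * dist (x i) (x j)"
proof -
  obtain s A v where s: "s > 0" "orthogonal_matrix A" and y: "\<And>i. y i = s *\<^sub>R (A *v x i) + v"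
    using assms unfolding similar_def by blast
  have "dist (y i) (y j) = s * dist (x i) (x j)" for i j
  proof -
    have "y i - y j = s *\<^sub>R (A *v (x i - x j))"
      unfolding y by (simp add: matrix_vector_mult_diff_distrib scaleR_diff_right)
    then show ?thesis using s by (simp add: dist_norm orthogonal_matrix_norm)
  qed
  then show ?thesis using that s by blast
qed

lemma rotation_matrix_plane:
  fixes A :: "real^2^2"
  shows "rotation_matrix A \<longleftrightarrow>
    A $ 2 $ 2 = A $ 1 $ 1 \<and> A $ 1 $ 2 = - A $ 2 $ 1 \<and> (A $ 1 $ 1)\<^sup>2 + (A $ 2 $ 1)\<^sup>2 = 1"
proof -
  have 1: "rotation_matrix A \<longleftrightarrow> (A $ 1 $ 1 * A $ 1 $ 1 + A $ 2 $ 1 * A $ 2 $ 1 = 1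
    \<and> A $ 1 $ 1 * A $ 1 $ 2 + A $ 2 $ 1 * A $ 2 $ 2 = 0
    \<and> A $ 1 $ 2 * A $ 1 $ 1 + A $ 2 $ 2 * A $ 2 $ 1 = 0
    \<and> A $ 1 $ 2 * A $ 1 $ 2 + A $ 2 $ 2 * A $ 2 $ 2 = 1) \<and> A $ 1 $ 1 * A $ 2 $ 2 - A $ 1 $ 2 * A $ 2 $ 1 = 1"
    unfolding rotation_matrix_def orthogonal_matrix det_2
    by (simp add: vec_eq_iff forall_2 matrix_matrix_mult_def transpose_def mat_def sum_2)
  show ?thesis
  proof
    assume "rotation_matrix A"
    note h = this[unfolded 1]
    have "A $ 2 $ 2 = A $ 1 $ 1" "A $ 1 $ 2 = - A $ 2 $ 1" "(A $ 1 $ 1)\<^sup>2 + (A $ 2 $ 1)\<^sup>2 = 1"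
      using h by algebra+
    then show "A $ 2 $ 2 = A $ 1 $ 1 \<and> A $ 1 $ 2 = - A $ 2 $ 1 \<and> (A $ 1 $ 1)\<^sup>2 + (A $ 2 $ 1)\<^sup>2 = 1" by blast
  next
    assume "A $ 2 $ 2 = A $ 1 $ 1 \<and> A $ 1 $ 2 = - A $ 2 $ 1 \<and> (A $ 1 $ 1)\<^sup>2 + (A $ 2 $ 1)\<^sup>2 = 1"
    then show "rotation_matrix A" unfolding 1 by (simp add: power2_eq_square algebra_simps)
  qed
qed

text \<open>
  A rotation, a scaling and a translation bring the segment from \<open>x 3\<close> to \<open>x 4\<close> to any given
  position on the first axis centred at the origin.
\<close>

lemma direct_similar_normal_form:
  fixes x :: config
  assumes "x 3 \<noteq> x 4" and d: "d > 0"
  obtains y where "(y, x) \<in> direct_similar" "y 3 = vector [- d, 0]" "y 4 = vector [d, 0]"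
proof -
  define n where "n = dist (x 3) (x 4)"
  define p q where "p = (x 4 $ 1 - x 3 $ 1) / n" and "q = (x 4 $ 2 - x 3 $ 2) / n"
  have n: "n > 0" using assms by (simp add: n_def)
  have n2: "n\<^sup>2 = (x 4 $ 1 - x 3 $ 1)\<^sup>2 + (x 4 $ 2 - x 3 $ 2)\<^sup>2"
    unfolding n_def dist_plane by (simp add: power2_commute)
  have pq: "p\<^sup>2 + q\<^sup>2 = 1"
  proof -
    have "p\<^sup>2 + q\<^sup>2 = ((x 4 $ 1 - x 3 $ 1)\<^sup>2 + (x 4 $ 2 - x 3 $ 2)\<^sup>2) / n\<^sup>2"
      by (simp add: p_def q_def power_divide add_divide_distrib)
    then show ?thesis unfolding n2[symmetric] using n by simp
  qed
  define A :: "real^2^2" where "A = vector [vector [p, - q], vector [q, p]]"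
  define B :: "real^2^2" where "B = vector [vector [p, q], vector [- q, p]]"
  define s where "s = n / (2 * d)"
  define y :: config where "y i = (1 / s) *\<^sub>R (B *v (x i - midpoint (x 3) (x 4)))" for i
  have s: "s > 0" using n d by (simp add: s_def)
  have A: "rotation_matrix A" unfolding rotation_matrix_plane using pq by (simp add: A_def)
  have AB: "A *v (B *v v) = v" for v
  proof -
    have "p * (p * v $ 1 + q * v $ 2) - q * (p * v $ 2 - q * v $ 1) = v $ 1"
      "q * (p * v $ 1 + q * v $ 2) + p * (p * v $ 2 - q * v $ 1) = v $ 2"
      using pq by algebra+
    then show ?thesis by (simp add: vec_eq_iff forall_2 matrix_vector_mult_def sum_2 A_def B_def)
  qed
  have "x i = s *\<^sub>R (A *v y i) + midpoint (x 3) (x 4)" for i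
    unfolding y_def using s by (simp add: matrix_vector_mult_scaleR AB)
  then have "(y, x) \<in> direct_similar" unfolding direct_similar_def using s A by blast
  moreover have D: "B *v (x 4 - x 3) = vector [n, 0]"
  proof -
    have D: "x 4 $ 1 - x 3 $ 1 = n * p" "x 4 $ 2 - x 3 $ 2 = n * q" using n by (simp_all add: p_def q_def)
    have "p * (x 4 $ 1 - x 3 $ 1) + q * (x 4 $ 2 - x 3 $ 2) = n"
      "p * (x 4 $ 2 - x 3 $ 2) - q * (x 4 $ 1 - x 3 $ 1) = 0"
      using pq D by algebra+
    then show ?thesis
      by (simp add: vec_eq_iff forall_2 matrix_vector_mult_def sum_2 B_def)
  qed
  moreover have "x 4 - midpoint (x 3) (x 4) = (1/2) *\<^sub>R (x 4 - x 3)"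
    "x 3 - midpoint (x 3) (x 4) = (- 1/2) *\<^sub>R (x 4 - x 3)"
    by (simp_all add: vec_eq_iff midpoint_def field_simps)
  then have "y 4 = (1 / s) *\<^sub>R (1/2) *\<^sub>R (B *v (x 4 - x 3))" "y 3 = (1 / s) *\<^sub>R (- 1/2) *\<^sub>R (B *v (x 4 - x 3))"
    unfolding y_def by (simp_all only: matrix_vector_mult_scaleR)
  then have "y 4 = vector [d, 0]" "y 3 = vector [- d, 0]"
    unfolding D using n d by (simp_all add: vec_eq_iff forall_2 s_def)
  ultimately show ?thesis using that by blast
qed

text \<open>
  The distances to \<open>y 3\<close> and \<open>y 4\<close> determine \<open>y 1\<close> and \<open>y 2\<close> up to the signs of
  their second coordinates; the distance between \<open>y 1\<close> and \<open>y 2\<close> couples these signs, and the remaining one is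
  the sign of \<open>r\<close>.
\<close>

lemma canonical_of_distances:
  fixes y :: config
  assumes l: "l\<^sup>2 = 4 + k\<^sup>2" and r0: "r0\<^sup>2 = 3"
    and y: "y 3 = vector [- (l\<^sup>2 - 1), 0]" "y 4 = vector [l\<^sup>2 - 1, 0]"
    and dist: "\<And>i j. (dist (y i) (y j))\<^sup>2 = (dist (canonical_config k l r0 i) (canonical_config k l r0 j))\<^sup>2"
  shows "\<exists>r. r\<^sup>2 = 3 \<and> y = canonical_config k l r"
proof -
  define d where "d = l\<^sup>2 - 1"
  note nz = canonical_nonzero[OF l]
  have d0: "d \<noteq> 0" using nz by (simp add: d_def)
  define a e a' e' where "a = y 1 $ 1" and "e = y 1 $ 2" and "a' = y 2 $ 1" and "e' = y 2 $ 2"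
  note D = canonical_dist[OF l r0, folded dist, folded d_def, unfolded dist_plane y[folded d_def] vector_2,
      folded a_def a'_def e_def e'_def]
  have "d * (a - (l + 1) * k) = 0" "d * (a' + (l - 1) * k) = 0" using D by algebra+
  then have aa: "a = (l + 1) * k" "a' = - ((l - 1) * k)" using d0 by auto
  have e2: "e\<^sup>2 = 3 * (l + 1)\<^sup>2" "e'\<^sup>2 = 3 * (l - 1)\<^sup>2"
    using D(2,4) l d_def unfolding aa by algebra+
  have ee: "e * e' = 3 * d" using D(1) l d_def e2 unfolding aa by algebra
  define r where "r = e / (l + 1)"
  have e: "e = (l + 1) * r" using nz by (simp add: r_def)
  have r2: "r\<^sup>2 = 3" using e2(1) nz by (simp add: r_def power_divide)
  have "(l + 1) * (e' - (l - 1) * r) * r = 0" using ee r2 unfolding e d_def by algebra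
  moreover have "r \<noteq> 0" using r2 by auto
  ultimately have e': "e' = (l - 1) * r" using nz by simp
  have "y i = canonical_config k l r i" for i
    using exhaust_4[of i] y aa e e' unfolding a_def a'_def e_def e'_def
    by (auto simp: canonical_config_simps vec_eq_iff forall_2)
  then show ?thesis using r2 by blast
qed

text \<open>
  The third and fourth points are the same in both configurations, so the scaling factor is 1.
  The distances of the first point to them then recover \<open>l\<close>, whose square is known, and \<open>k\<close>.
\<close>

lemma canonical_similar_imp_eq:
  assumes p: "(k, l, r) \<in> canonical_parameters m" "(k', l', r') \<in> canonical_parameters m"
    and sim: "(canonical_config k l r, canonical_config k' l' r') \<in> similar"
  shows "k = k' \<and> l = l'"
proof -
  have l: "l\<^sup>2 = 4 + k\<^sup>2" "r\<^sup>2 = 3" "l'\<^sup>2 = 4 + k'\<^sup>2" "r'\<^sup>2 = 3" and ll: "l'\<^sup>2 = l\<^sup>2"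
    using p by (auto simp: canonical_parameters_def)
  note nz = canonical_nonzero[OF l(1)]
  have l1: "l\<^sup>2 - 1 \<noteq> 0" using nz by simp
  obtain s where s: "s > 0" and d: "\<And>i j. dist (canonical_config k' l' r' i) (canonical_config k' l' r' j)
    = s * dist (canonical_config k l r i) (canonical_config k l r j)"
    using similar_dist[OF sim] by blast
  have d2: "(dist (canonical_config k' l' r' i) (canonical_config k' l' r' j))\<^sup>2
    = s\<^sup>2 * (dist (canonical_config k l r i) (canonical_config k l r j))\<^sup>2" for i j
    unfolding d by (simp add: power_mult_distrib)
  note D = canonical_dist[OF l(3,4), unfolded d2 canonical_dist[OF l(1,2)] ll]
  have s1: "s\<^sup>2 = 1" using D(6) l1 by simp
  have "(l\<^sup>2 - 1) * (l - l') = 0" using D(2,3) ll unfolding s1 by algebra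
  then have l': "l' = l" using l1 by simp
  have "(l\<^sup>2 - 1) * (l + 1) * (k - k') = 0" using D(2,3) unfolding s1 l' by algebra
  then show ?thesis using l1 nz l' by simp
qed

text \<open>
  The motion fixes the third and fourth points, and a rotation that does so is the identity.
\<close>

lemma canonical_direct_similar_imp_eq:
  assumes p: "(k, l, r) \<in> canonical_parameters m" "(k', l', r') \<in> canonical_parameters m"
    and sim: "(canonical_config k l r, canonical_config k' l' r') \<in> direct_similar"
  shows "k = k' \<and> l = l' \<and> r = r'"
proof -
  have kl: "k' = k" "l' = l"
    using canonical_similar_imp_eq[OF p direct_similar_imp_similar[OF sim]] by simp_all
  have l: "l\<^sup>2 = 4 + k\<^sup>2" using p by (auto simp: canonical_parameters_def)
  note nz = canonical_nonzero[OF l]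
  have l1: "l\<^sup>2 - 1 > 0" using nz by simp
  obtain s A v where s: "s > 0" "rotation_matrix A"
    and y: "\<And>i. canonical_config k l r' i = s *\<^sub>R (A *v canonical_config k l r i) + v"
    using sim unfolding kl direct_similar_def by blast
  note A = s(2)[unfolded rotation_matrix_plane]
  have y': "canonical_config k l r' i $ 1 = s * (A $ 1 $ 1 * canonical_config k l r i $ 1 + A $ 1 $ 2 * canonical_config k l r i $ 2) + v $ 1"
    "canonical_config k l r' i $ 2 = s * (A $ 2 $ 1 * canonical_config k l r i $ 1 + A $ 2 $ 2 * canonical_config k l r i $ 2) + v $ 2"
    for i unfolding y by (simp_all add: matrix_vector_mult_def sum_2)
  note h = y'[of 3, unfolded canonical_config_simps vector_2] y'[of 4, unfolded canonical_config_simps vector_2]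
    y'[of 1, unfolded canonical_config_simps vector_2]
  have "(l\<^sup>2 - 1) * (s * A $ 1 $ 1 - 1) = 0" using h(1,3) by algebra
  then have a: "s * A $ 1 $ 1 = 1" using l1 by simp
  have "(l\<^sup>2 - 1) * (s * A $ 2 $ 1) = 0" using h(2,4) by algebra
  then have b: "s * A $ 2 $ 1 = 0" using l1 by simp
  have v: "v $ 2 = 0" using h(2,4) by algebra
  have "(l + 1) * (r' - r) = 0" using h(6) A a b v by algebra
  then show ?thesis using nz kl by simp
qed

lemma canonical_reflection:
  "(canonical_config k l r, canonical_config k l (- r)) \<in> similar"
proof -
  define A :: "real^2^2" where "A = vector [vector [1, 0], vector [0, -1]]"
  have "orthogonal_matrix A" unfolding orthogonal_matrix
    by (simp add: A_def vec_eq_iff forall_2 matrix_matrix_mult_def transpose_def mat_def sum_2)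
  moreover have "canonical_config k l (- r) i = 1 *\<^sub>R (A *v canonical_config k l r i) + 0" for i
    using exhaust_4[of i]
    by (auto simp: A_def vec_eq_iff forall_2 matrix_vector_mult_def sum_2 canonical_config_simps)
  ultimately show ?thesis unfolding similar_def using zero_less_one by blast
qed

section \<open>Classification and count\<close>

text \<open>
  Asymmetry excludes the kites and trapezoids, the algebra then fixes \<open>k\<^sup>2\<close>, \<open>l\<^sup>2\<close> and all
  ratios of distances, and the ratios determine the configuration up to a similarity.
\<close>

lemma asymmetric_equilibrium_is_canonical:
  assumes m: "-1 < m" "m < 1" "m \<noteq> 0" and x: "x \<in> asymmetric_equilibria m"
  shows "\<exists>k l r. (k, l, r) \<in> canonical_parameters m \<and> (canonical_config k l r, x) \<in> direct_similar"
proof -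
  have re: "relative_equilibrium (two_pair_strengths m) x" and nc: "\<not> collinear (range x)"
    and as: "asymmetric x" using x by (simp_all add: asymmetric_equilibria_def strictly_planar_def)
  have inj: "inj x" using re by (simp add: relative_equilibrium_def)
  have m1: "m + 1 \<noteq> 0" "m + 2 \<noteq> 0" "1 + m \<noteq> 0" using m by auto
  have G1: "two_pair_strengths m i \<noteq> 0" for i using m by (simp add: two_pair_strengths_def)
  have G2: "(\<Sum>i\<in>UNIV. two_pair_strengths m i) \<noteq> 0" using m by (simp add: sum_4)
  obtain lam t b where lam: "lam \<noteq> 0"
    and b0: "(\<Sum>i\<in>UNIV. two_pair_strengths m i * b i) = 0"
    and bx: "(\<Sum>i\<in>UNIV. (two_pair_strengths m i * b i) *\<^sub>R x i) = 0"
    and d: "\<And>i j. i \<noteq> j \<Longrightarrow> 1 / (dist (x i) (x j))\<^sup>2 = lam * (1 + t * b i * b j)"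
    by (rule dziobek[OF re nc G1 G2]) (rule that)
  define g where "g i j = 1 + t * b i * b j" for i j
  have gd: "dist (x i) (x j) = dist (x i') (x j')" if "g i j = g i' j'" "i \<noteq> j" "i' \<noteq> j'" for i j i' j'
  proof -
    have "1 / (dist (x i) (x j))\<^sup>2 = 1 / (dist (x i') (x j'))\<^sup>2"
      using that d unfolding g_def by simp
    then show ?thesis by simp
  qed
  have dne: "dist (x i) (x j) \<noteq> 0" if "i \<noteq> j" for i j using that inj by (simp add: inj_eq)
  have gne: "g i j \<noteq> 0" if "i \<noteq> j" for i j
    using d[OF that] dne[OF that] by (auto simp: g_def)
  have ds: "w * (dist (x i) (x j))\<^sup>2 = w / g i j / lam" if "i \<noteq> j" for i j w
  proof -
    have "lam * g i j * (dist (x i) (x j))\<^sup>2 = 1"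
      using d[OF that] dne[OF that] by (simp add: g_def field_simps)
    then show ?thesis using gne[OF that] lam by (simp add: field_simps)
  qed
  have x12: "x 1 \<noteq> x 2" and x34: "x 3 \<noteq> x 4" using inj by (simp_all add: inj_eq)
  have g12: "\<not> (g 1 3 = g 2 3 \<and> g 1 4 = g 2 4)"
  proof
    assume "g 1 3 = g 2 3 \<and> g 1 4 = g 2 4"
    then have "dist (x 1) (x 3) = dist (x 2) (x 3)" "dist (x 1) (x 4) = dist (x 2) (x 4)"
      by (auto intro!: gd)
    then show False using kite_not_asymmetric[OF x12 UNIV_4] as by blast
  qed
  then have b12: "b 1 \<noteq> b 2" and t0: "t \<noteq> 0" by (auto simp: g_def)
  have b34: "b 3 \<noteq> b 4"
  proof
    assume "b 3 = b 4"
    then have "dist (x 3) (x 1) = dist (x 4) (x 1)" "dist (x 3) (x 2) = dist (x 4) (x 2)"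
      by (auto intro!: gd simp: g_def)
    moreover have "UNIV = {3, 4, 1, 2 :: 4}" by (simp add: UNIV_4 insert_commute)
    ultimately show False using kite_not_asymmetric[OF x34] as by blast
  qed
  have lin: "b 1 + b 2 + m * b 3 + m * b 4 = 0" using b0 by (simp add: sum_4)
  (* Here b2 = -b1 and b4 = -b3: the dependency makes x1 - x2 and x3 - x4 parallel, and Dziobek's
     equations give the distance equalities of an isosceles trapezoid. *)
  have u0: "b 3 + b 4 \<noteq> 0"
  proof
    assume u: "b 3 + b 4 = 0"
    then have b4: "b 4 = - b 3" by simp
    have b2: "b 2 = - b 1" using lin unfolding b4 by simp
    have b3: "b 3 \<noteq> 0" using b34 b4 by auto
    have "b 1 *\<^sub>R (x 1 - x 2) + (m * b 3) *\<^sub>R (x 3 - x 4) = 0"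
      using bx by (simp add: sum_4 b2 b4 algebra_simps)
    then have "(m * b 3) *\<^sub>R (x 3 - x 4) = (- b 1) *\<^sub>R (x 1 - x 2)"
      by (simp add: add_eq_0_iff2)
    then have "(1 / (m * b 3)) *\<^sub>R ((m * b 3) *\<^sub>R (x 3 - x 4)) = (1 / (m * b 3)) *\<^sub>R ((- b 1) *\<^sub>R (x 1 - x 2))"
      by simp
    then have "x 3 - x 4 = (- b 1 / (m * b 3)) *\<^sub>R (x 1 - x 2)"
      using b3 m by simp
    moreover have "dist (x 1) (x 3) = dist (x 2) (x 4)" "dist (x 1) (x 4) = dist (x 2) (x 3)"
      by (auto intro!: gd simp: g_def b2 b4)
    ultimately show False using trapezoid_not_asymmetric[OF x12 UNIV_4] as by blast
  qed
  define T where "T = lam * (\<Sum>j\<in>UNIV. two_pair_strengths m j * b j * (norm (x j))\<^sup>2)"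
  have tt: "lam * (\<Sum>j\<in>UNIV. two_pair_strengths m j * b j * (dist (x i) (x j))\<^sup>2) = T" for i
    unfolding T_def dependency_dist_const[OF b0 bx] ..
  have core: "t * b 1 * b 2 = m \<and> t * b 3 * b 4 = - 1 / (m + 2)
       \<and> t * (b 3 + b 4)\<^sup>2 = - 2 * (m + 1) / (m * (m + 2))"
  proof (rule asymmetric_dziobek_solutions[OF lin, of "g 1 2" t "g 1 3" "g 1 4" "g 2 3" "g 2 4" "g 3 4" T])
    have gs: "g i j = g j i" for i j by (simp add: g_def)
    show "b 2 / g 1 2 + m * b 3 / g 1 3 + m * b 4 / g 1 4 = T"
      using tt[of 1] lam by (simp add: sum_4 ds distrib_left)
    show "b 1 / g 1 2 + m * b 3 / g 2 3 + m * b 4 / g 2 4 = T"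
      using tt[of 2] lam by (simp add: sum_4 ds distrib_left gs)
    show "b 1 / g 1 3 + b 2 / g 2 3 + m * b 4 / g 3 4 = T"
      using tt[of 3] lam by (simp add: sum_4 ds distrib_left gs)
    show "b 1 / g 1 4 + b 2 / g 2 4 + m * b 3 / g 3 4 = T"
      using tt[of 4] lam by (simp add: sum_4 ds distrib_left gs)
  qed (use g_def gne b12 b34 u0 t0 m in auto)
  define W where "W = - 2 * (m + 1) / (m * (m + 2))"
  define u k l where "u = b 3 + b 4" and "k = (b 3 - b 4) / u" and "l = (b 1 - b 2) / (m * u)"
  have uk: "u * k = b 3 - b 4" and ul: "m * (u * l) = b 1 - b 2"
    using u0 m by (simp_all add: u_def k_def l_def)
  have bw: "b i = u * canonical_weight m k l i" for i
  proof -
    have "2 * b 1 = u * (m * (l - 1))" "2 * b 2 = - (u * (m * (l + 1)))"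
      "2 * b 3 = u * (1 + k)" "2 * b 4 = u * (1 - k)"
      using uk ul lin u_def by algebra+
    then show ?thesis using exhaust_4[of i] by (auto simp: canonical_weight_simps)
  qed
  have tW: "t * u\<^sup>2 = W" using core by (simp add: u_def W_def)
  have "W * (m * (m + 2)) = - 2 * (m + 1)" using m m1 by (simp add: W_def)
  then have Wm: "W * m * (m + 2) = - 2 * (m + 1)" by (simp add: mult.assoc)
  have V: "t * b 3 * b 4 * (m + 2) = - 1" using core m1 by simp
  have W0: "W * (m + 2) \<noteq> 0" using Wm m1 by auto
  have "W * (1 - k\<^sup>2) = 4 * (t * b 3 * b 4)"
    unfolding bw canonical_weight_simps tW[symmetric] by (simp add: field_simps power2_eq_square)
  then have "W * (m + 2) * (k\<^sup>2 * (1 + m) - (1 - m)) = 0" using V Wm by algebra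
  then have "k\<^sup>2 * (1 + m) = 1 - m" using W0 by simp
  then have k2: "k\<^sup>2 = (1 - m) / (1 + m)" using m1 by (simp add: nonzero_eq_divide_eq)
  have "W * m\<^sup>2 * (1 - l\<^sup>2) = 4 * (t * b 1 * b 2)"
    unfolding bw canonical_weight_simps tW[symmetric] by (simp add: field_simps power2_eq_square)
  then have "m * (W * m * (1 - l\<^sup>2) - 4) = 0" using core by algebra
  then have Wl: "W * m * (1 - l\<^sup>2) = 4" using m by simp
  have "W * m * ((1 + m) * (l\<^sup>2 - 1) - 2 * (m + 2)) = - (1 + m) * (W * m * (1 - l\<^sup>2)) - 2 * (W * m * (m + 2))"
    by (simp add: algebra_simps)
  also have "\<dots> = 0" unfolding Wl Wm by simp
  finally have "W * m * ((1 + m) * (l\<^sup>2 - 1) - 2 * (m + 2)) = 0" .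
  then have "(1 + m) * (l\<^sup>2 - 1) = 2 * (m + 2)" using W0 m by simp
  then have "(1 + m) * (l\<^sup>2 - 4 - k\<^sup>2) = 0" using \<open>k\<^sup>2 * (1 + m) = 1 - m\<close> by algebra
  then have l2: "l\<^sup>2 = 4 + k\<^sup>2" using m1 by simp
  have r: "(sqrt 3)\<^sup>2 = (3::real)" by simp
  let ?C = "canonical_config k l (sqrt 3)"
  define K where "K = lam * (8 * (l\<^sup>2 - 1))"
  note nz = canonical_nonzero[OF l2]
  have K0: "K \<noteq> 0" using lam nz by (simp add: K_def)
  have CK: "(dist (?C i) (?C j))\<^sup>2 = K * (dist (x i) (x j))\<^sup>2" for i j
  proof (cases "i = j")
    case False
    have "1 / (dist (x i) (x j))\<^sup>2 = lam * (1 + W * canonical_weight m k l i * canonical_weight m k l j)"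
      unfolding d[OF False] tW[symmetric] bw by (simp add: power2_eq_square mult_ac)
    then have "1 / (dist (x i) (x j))\<^sup>2 = K * (1 / (dist (?C i) (?C j))\<^sup>2)"
      unfolding canonical_dziobek[OF m k2 l2 r W_def False] K_def using nz by simp
    moreover have "dist (?C i) (?C j) \<noteq> 0" using canonical_inj[OF l2 r] False by (simp add: inj_eq)
    ultimately show ?thesis using dne[OF False] by (simp add: field_simps)
  qed simp
  have "l\<^sup>2 - 1 > 0" using nz by simp
  with x34 obtain y where y: "(y, x) \<in> direct_similar" "y 3 = vector [- (l\<^sup>2 - 1), 0]" "y 4 = vector [l\<^sup>2 - 1, 0]"
    using direct_similar_normal_form by metis
  obtain s where s: "s > 0" "\<And>i j. dist (x i) (x j) = s * dist (y i) (y j)"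
    using similar_dist[OF direct_similar_imp_similar[OF y(1)]] by blast
  have Cy: "(dist (?C i) (?C j))\<^sup>2 = (K * s\<^sup>2) * (dist (y i) (y j))\<^sup>2" for i j
    unfolding CK s(2) by (simp add: power_mult_distrib)
  have "(dist (y 3) (y 4))\<^sup>2 = 4 * (l\<^sup>2 - 1)\<^sup>2"
    unfolding dist_plane y vector_2 by (simp add: algebra_simps power2_eq_square)
  then have "4 * (l\<^sup>2 - 1)\<^sup>2 = (K * s\<^sup>2) * (4 * (l\<^sup>2 - 1)\<^sup>2)"
    using Cy[of 3 4] unfolding canonical_dist[OF l2 r] by simp
  moreover have "4 * (l\<^sup>2 - 1)\<^sup>2 \<noteq> 0" using \<open>l\<^sup>2 - 1 > 0\<close> by simp
  ultimately have "K * s\<^sup>2 = 1" by (metis mult_cancel_right1)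
  then have "(dist (y i) (y j))\<^sup>2 = (dist (?C i) (?C j))\<^sup>2" for i j using Cy by simp
  then obtain r where "r\<^sup>2 = 3" "y = canonical_config k l r"
    using canonical_of_distances[OF l2 r y(2,3)] by blast
  then show ?thesis using y(1) k2 l2 unfolding canonical_parameters_def by blast
qed

lemma card_quotient_representatives:
  assumes eq: "equiv UNIV R" and sub: "f ` P \<subseteq> X"
    and cover: "\<And>x. x \<in> X \<Longrightarrow> \<exists>p\<in>P. (f p, x) \<in> R"
    and ne: "\<And>p q. p \<in> P \<Longrightarrow> q \<in> P \<Longrightarrow> (f p, f q) \<in> R \<Longrightarrow> p = q"
  shows "card (X // R) = card P"
proof -
  have "X // R = (\<lambda>p. R `` {f p}) ` P"
  proof (intro equalityI subsetI)
    fix c assume "c \<in> X // R"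
    then obtain x where x: "x \<in> X" "c = R `` {x}" by (rule quotientE)
    then obtain p where "p \<in> P" "(f p, x) \<in> R" using cover by blast
    then show "c \<in> (\<lambda>p. R `` {f p}) ` P" using x equiv_class_eq[OF eq] by blast
  next
    fix c assume "c \<in> (\<lambda>p. R `` {f p}) ` P"
    then obtain p where "p \<in> P" and c: "c = R `` {f p}" by blast
    then have "f p \<in> X" using sub by blast
    then show "c \<in> X // R" unfolding c by (rule quotientI)
  qed
  moreover have "inj_on (\<lambda>p. R `` {f p}) P"
    using ne eq_equiv_class_iff[OF eq] by (auto intro!: inj_onI)
  ultimately show ?thesis by (simp add: card_image)
qed

lemma canonical_in_asymmetric_equilibria:
  assumes m: "-1 < m" "m < 1" "m \<noteq> 0" and p: "(k, l, r) \<in> canonical_parameters m"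
  shows "canonical_config k l r \<in> asymmetric_equilibria m"
proof -
  have q: "k\<^sup>2 = (1 - m) / (1 + m)" "l\<^sup>2 = 4 + k\<^sup>2" "r\<^sup>2 = 3"
    using p by (auto simp: canonical_parameters_def)
  have "k \<noteq> 0" "k\<^sup>2 \<noteq> 1" using q(1) m by (auto simp: field_simps)
  then show ?thesis
    unfolding asymmetric_equilibria_def
    using canonical_equilibrium[OF m p] canonical_strictly_planar[OF q(2,3)] canonical_asymmetric[OF q(2,3)]
    by simp
qed

lemma canonical_parameters_product:
  assumes "-1 < m" "m < 1"
  obtains k0 l0 where "k0 > 0" "l0 > 0"
    "canonical_parameters m = {k0, - k0} \<times> {l0, - l0} \<times> {sqrt 3, - sqrt 3}"
proof -
  define k0 where "k0 = sqrt ((1 - m) / (1 + m))"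
  define l0 where "l0 = sqrt (4 + k0\<^sup>2)"
  have k: "k0 > 0" "k0\<^sup>2 = (1 - m) / (1 + m)" using assms by (simp_all add: k0_def)
  have "4 + k0\<^sup>2 > 0" using zero_le_power2[of k0] by linarith
  then have l: "l0 > 0" "l0\<^sup>2 = 4 + k0\<^sup>2" unfolding l0_def by simp_all
  have "canonical_parameters m = {(k, l, r). k\<^sup>2 = k0\<^sup>2 \<and> l\<^sup>2 = l0\<^sup>2 \<and> r\<^sup>2 = (sqrt 3)\<^sup>2}"
    unfolding canonical_parameters_def l(2) k(2)[symmetric] by auto
  then have "canonical_parameters m = {k0, - k0} \<times> {l0, - l0} \<times> {sqrt 3, - sqrt 3}"
    unfolding power2_eq_iff by auto
  then show ?thesis using that k l by blast
qed

theorem theorem6p10: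
  fixes m :: real
  assumes "-1 < m" and "m < 1" and "m \<noteq> 0"
  shows "card (asymmetric_equilibria m // similar) = 4
       \<and> card (asymmetric_equilibria m // direct_similar) = 8
       \<and> (m < 0 \<longrightarrow> (\<forall>x \<in> asymmetric_equilibria m. convex_config x))
       \<and> (m > 0 \<longrightarrow> (\<forall>x \<in> asymmetric_equilibria m. concave_config x))"
proof -
  let ?f = "\<lambda>(k, l, r). canonical_config k l r"
  let ?P = "canonical_parameters m"
  obtain k0 l0 where kl0: "k0 > 0" "l0 > 0" and P: "?P = {k0, - k0} \<times> {l0, - l0} \<times> {sqrt 3, - sqrt 3}"
    using canonical_parameters_product[OF assms(1,2)] .
  define P' where "P' = {k0, - k0} \<times> {l0, - l0} \<times> {sqrt 3}"
  have P': "P' \<subseteq> ?P" unfolding P P'_def by blast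
  have "card {a, - a} = 2" if "a > 0" for a :: real using that by simp
  then have card: "card ?P = 8" "card P' = 4"
    using kl0 unfolding P P'_def card_cartesian_product by simp_all
  have sub: "?f ` ?P \<subseteq> asymmetric_equilibria m"
    using canonical_in_asymmetric_equilibria[OF assms] by auto
  have "card (asymmetric_equilibria m // direct_similar) = 8"
    unfolding card(1)[symmetric]
  proof (rule card_quotient_representatives[OF equiv_direct_similar sub])
    show "\<exists>p\<in>?P. (?f p, x) \<in> direct_similar" if "x \<in> asymmetric_equilibria m" for x
      using asymmetric_equilibrium_is_canonical[OF assms that] by force
    show "p = q" if "p \<in> ?P" "q \<in> ?P" "(?f p, ?f q) \<in> direct_similar" for p q
      using that canonical_direct_similar_imp_eq by (cases p; cases q) auto
  qed
  moreover have "card (asymmetric_equilibria m // similar) = 4"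
    unfolding card(2)[symmetric]
  proof (rule card_quotient_representatives[OF equiv_similar])
    show "?f ` P' \<subseteq> asymmetric_equilibria m" using sub P' by blast
    show "\<exists>p\<in>P'. (?f p, x) \<in> similar" if x: "x \<in> asymmetric_equilibria m" for x
    proof -
      obtain k l r where klr: "(k, l, r) \<in> ?P" and s: "(canonical_config k l r, x) \<in> similar"
        using asymmetric_equilibrium_is_canonical[OF assms x] direct_similar_imp_similar by blast
      have in_P': "(k, l, sqrt 3) \<in> P'" and "r = sqrt 3 \<or> r = - sqrt 3"
        using klr unfolding P P'_def by auto
      then have "(canonical_config k l (sqrt 3), canonical_config k l r) \<in> similar"
        using canonical_reflection[of k l "sqrt 3"] equiv_similar
        by (auto simp: equiv_def refl_on_def)
      then have "(canonical_config k l (sqrt 3), x) \<in> similar"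
        using s equiv_similar by (meson equiv_def transE)
      then show ?thesis using in_P' by force
    qed
    show "p = q" if pq: "p \<in> P'" "q \<in> P'" "(?f p, ?f q) \<in> similar" for p q
    proof -
      have *: "\<exists>k l. p = (k, l, sqrt 3)" if "p \<in> P'" for p
        using that unfolding P'_def by (cases p) auto
      obtain k l k' l' where "p = (k, l, sqrt 3)" "q = (k', l', sqrt 3)"
        using *[OF pq(1)] *[OF pq(2)] by blast
      then show ?thesis using pq P' canonical_similar_imp_eq by fastforce
    qed
  qed
  moreover have "(m < 0 \<longrightarrow> convex_config x) \<and> (m > 0 \<longrightarrow> concave_config x)"
    if x: "x \<in> asymmetric_equilibria m" for x
  proof -
    obtain k l r where "(k, l, r) \<in> ?P" and s: "(canonical_config k l r, x) \<in> direct_similar"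
      using asymmetric_equilibrium_is_canonical[OF assms x] by blast
    then have "k\<^sup>2 = (1 - m) / (1 + m)" "l\<^sup>2 = 4 + k\<^sup>2" by (auto simp: canonical_parameters_def)
    moreover have "inj x" "\<not> collinear (range x)"
      using x by (auto simp: asymmetric_equilibria_def relative_equilibrium_def strictly_planar_def)
    ultimately show ?thesis using shape_of_similar_to_canonical[OF assms _ _ s] by blast
  qed
  ultimately show ?thesis by blast
qed

end
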